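(* For every integer $N\geq 2$, $$B_0(N,2)=2\sum_{i=0}^{N-3}B_0(i)\,B_0(N-i-1,2)+\frac{N(N-1)}{2}\,B_0(N-1).$$
   Context: Let $N\ge 1$, $K\ge 1$. A gluing datum with $N$ edges and $K$ faces consists of a composition $(m_1,\dots,m_K)$ of $2N$ into positive integers and a fixed-point-free involution $\iota$ of $\{1,\dots,2N\}$. With $s_0=0$, $s_i=m_1+\dots+m_i$, let $\tau$ have cycles $(s_{i-1}+1,\dots,s_i)$, $i=1,\dots,K$. The datum is connected if $\langle\iota,\tau\rangle$ is transitive, and has genus $g$ if $\tau\iota$ has $N-K+2-2g$ cycles. The datum is bicolored if every $m_i$ is even and $\iota$ maps every element $s_{i-1}+r$ with $r$ odd ("white" edges) to an element $s_{j-1}+r'$ with $r'$ even ("black" edges). (Geometrically: gluings of $K$ numbered polygons whose vertices are properly colored black/white, whose distinguished edge starts at a white vertex, glued pairwise with opposite orientations so that vertex colors match, into a connected closed orientable surface of genus $g$.) $B_g(N,K)$ is the number of connected bicolored gluing data of genus $g$ with $N$ edges and $K$ faces; $B_0(0,1)=1$, $B_g(0,K)=0$ if $g+K>1$, and $B_g(N):=B_g(N,1)$. *)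

theory Defs
  imports "HOL-Algebra.Sym_Groups" "HOL-Combinatorics.Orbits"
begin

text \<open>Polygons are indexed from 0: polygon \<open>i < length m\<close> has size \<open>m ! i\<close>, and its edges
  carry the labels \<open>offset m i + r\<close> with \<open>1 \<le> r \<le> m ! i\<close>.\<close>

definition offset :: "nat list \<Rightarrow> nat \<Rightarrow> nat" where
  "offset m i = sum_list (take i m)"

definition polygon :: "nat list \<Rightarrow> nat \<Rightarrow> nat list" where
  "polygon m i = [offset m i + 1 ..< offset m (Suc i) + 1]"

text \<open>The product of the cycles of all polygons; they are disjoint, so the order of
  composition does not matter.\<close>

definition face_perm :: "nat list \<Rightarrow> nat \<Rightarrow> nat" where
  "face_perm m = foldr (\<lambda>i p. cycle_of_list (polygon m i) \<circ> p) [0..<length m] id"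

text \<open>The involution is required to be the identity outside \<open>{1..2 * N}\<close> (this is part of
  \<open>permutes\<close>), so that each gluing datum is represented by exactly one pair.\<close>

definition gluing_datum :: "nat \<Rightarrow> nat \<Rightarrow> nat list \<times> (nat \<Rightarrow> nat) \<Rightarrow> bool" where
  "gluing_datum N K = (\<lambda>(m, \<iota>).
     length m = K \<and> (\<forall>k\<in>set m. 1 \<le> k) \<and> sum_list m = 2 * N \<and>
     \<iota> permutes {1..2 * N} \<and> (\<forall>x\<in>{1..2 * N}. \<iota> (\<iota> x) = x \<and> \<iota> x \<noteq> x))"

definition connected_gluing :: "nat \<Rightarrow> nat list \<times> (nat \<Rightarrow> nat) \<Rightarrow> bool" where
  "connected_gluing N = (\<lambda>(m, \<iota>).
     \<forall>x\<in>{1..2 * N}. \<forall>y\<in>{1..2 * N}.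
       \<exists>p\<in>generate (sym_group (2 * N)) {\<iota>, face_perm m}. p x = y)"

text \<open>Number of cycles on the invariant set \<open>S\<close>, fixed points included.\<close>

definition num_cycles :: "(nat \<Rightarrow> nat) \<Rightarrow> nat set \<Rightarrow> nat" where
  "num_cycles p S = card (orbit p ` S)"

definition has_genus :: "nat \<Rightarrow> nat \<Rightarrow> nat list \<times> (nat \<Rightarrow> nat) \<Rightarrow> nat \<Rightarrow> bool" where
  "has_genus N K = (\<lambda>(m, \<iota>) g.
     int (num_cycles (face_perm m \<circ> \<iota>) {1..2 * N}) = int N - int K + 2 - 2 * int g)"

definition bicolored :: "nat list \<times> (nat \<Rightarrow> nat) \<Rightarrow> bool" where
  "bicolored = (\<lambda>(m, \<iota>).
     (\<forall>k\<in>set m. even k) \<and>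
     (\<forall>i<length m. \<forall>r\<in>{1..m ! i}. odd r \<longrightarrow>
       (\<exists>j<length m. \<exists>r'\<in>{1..m ! j}. even r' \<and> \<iota> (offset m i + r) = offset m j + r')))"

definition bicolored_gluings :: "nat \<Rightarrow> nat \<Rightarrow> nat \<Rightarrow> (nat list \<times> (nat \<Rightarrow> nat)) set" where
  "bicolored_gluings g N K =
     {d. gluing_datum N K d \<and> connected_gluing N d \<and> has_genus N K d g \<and> bicolored d}"

definition B :: "nat \<Rightarrow> nat \<Rightarrow> nat \<Rightarrow> nat" where
  "B g N K = (if N = 0 then (if g = 0 \<and> K = 1 then 1 else 0) else card (bicolored_gluings g N K))"

lemma finite_bicolored_gluings: "finite (bicolored_gluings g N K)"
proof (rule finite_subset)
  show "bicolored_gluings g N K \<subseteq>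
      {m. set m \<subseteq> {..2 * N} \<and> length m = K} \<times> {\<iota>. \<iota> permutes {1..2 * N}}"
    by (auto simp: bicolored_gluings_def gluing_datum_def dest: member_le_sum_list)
  show "finite ({m. set m \<subseteq> {..2 * N} \<and> length m = K} \<times> {\<iota>. \<iota> permutes {1..2 * N}})"
    by (intro finite_cartesian_product finite_lists_length_eq finite_permutations) auto
qed

end

theory Submission
  imports Defs
begin

text \<open>Tutte's root-edge decomposition. Let \<open>\<iota>\<close> glue the first edge \<open>1\<close> to \<open>y\<close>, and compose both
  \<open>\<tau>\<close> and \<open>\<iota>\<close> with the transposition \<open>(1 y)\<close>. This does not change the vertex permutation \<open>\<tau> \<circ> \<iota>\<close>,
  turns \<open>1\<close> and \<open>y\<close> into fixed points of \<open>\<iota>\<close>, and merges the faces of \<open>1\<close> and \<open>y\<close> or splits their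
  common face. If \<open>y\<close> lies on the second face, the result is one polygon with \<open>2 * (N - 1)\<close> edges,
  to be glued to a sphere; summing over the positions of \<open>y\<close> gives the factor \<open>N * (N - 1) div 2\<close>.
  If \<open>y\<close> lies on the first face, that face splits in two, and Euler's inequality forces the result
  to be two spheres, one of which carries the second face.\<close>

subsection \<open>Orbits under transpositions\<close>

text \<open>The recursion is refined by face lengths, because the cut shortens the first face and
  leaves the second alone. It is proved for \<open>annulus a b\<close>, with faces of
  \<open>2 * a\<close> and \<open>2 * b\<close> edges, and summed over \<open>a + b = N\<close> at
  the end. The factor 2 records that the second face may go to either of the two spheres; the two
  resulting sums agree after renaming the index. The labels \<open>1\<close> and \<open>y\<close> do
  not disappear at once: the swap leaves them as unpaired fixed points of the involution, on faces
  that are no longer intervals of labels. So the counting is set up for any finite label set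
  \<open>S\<close>, any face permutation and a set \<open>F\<close> of unpaired labels. Unpaired
  labels are deleted one at a time, and the remaining faces are transported to standard intervals by
  a relabelling that keeps parity. Parity carries the coloring: white edges have odd labels, so the
  partner of \<open>1\<close> is some \<open>2 * j\<close>.\<close>

lemma orbit_subset_invariant:
  assumes "p ` T \<subseteq> T" "x \<in> T"
  shows "orbit p x \<subseteq> T"
proof
  fix y assume "y \<in> orbit p x"
  then show "y \<in> T" by induction (use assms in auto)
qed

lemma orbit_eq_of_mem:
  assumes "permutation p" "y \<in> orbit p x"
  shows "orbit p y = orbit p x"
  by (rule orbit_cyclic_eq3[OF cyclic_on_orbit'[OF assms(1)] assms(2)])

lemma orbit_image_orbit:
  assumes "permutation p"
  shows "orbit p ` orbit p x = {orbit p x}"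
proof -
  have "orbit p ` orbit p x = (\<lambda>_. orbit p x) ` orbit p x"
    by (rule image_cong[OF refl orbit_eq_of_mem[OF assms]])
  then show ?thesis using orbit_nonempty[of p x] by auto
qed

lemma orbit_disjoint:
  assumes "permutation p" "y \<notin> orbit p x"
  shows "orbit p x \<inter> orbit p y = {}"
  using orbit_eq_of_mem[OF assms(1)] permutation_self_in_orbit[OF assms(1)] assms(2) by blast

lemma orbit_cong_invariant:
  assumes "p ` T \<subseteq> T" "x \<in> T" "\<And>z. z \<in> T \<Longrightarrow> p z = q z"
  shows "orbit p x = orbit q x"
  by (rule orbit_cong0[where A = T]) (use assms in auto)

lemma comp_image_subset: "f ` T \<subseteq> T \<Longrightarrow> g ` T \<subseteq> T \<Longrightarrow> (f \<circ> g) ` T \<subseteq> T"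
  by (auto simp: image_subset_iff)

lemma transpose_image_subset: "x \<in> T \<longleftrightarrow> y \<in> T \<Longrightarrow> transpose x y ` T \<subseteq> T"
  by (auto simp: transpose_def)

lemma permutation_image_eq:
  assumes "permutation p" "finite S" "p ` S \<subseteq> S"
  shows "p ` S = S"
  by (rule endo_inj_surj[OF assms(2,3) inj_on_subset[OF bij_is_inj[OF permutation_bijective[OF assms(1)]]]])
    simp

text \<open>Injectivity on a finite set turns an inclusion of the image into an equality, so
  complements of closed sets are closed too.\<close>

lemma permutation_image_Diff:
  assumes "permutation p" "finite S" "p ` S \<subseteq> S" "p ` T \<subseteq> T" "T \<subseteq> S"
  shows "p ` (S - T) \<subseteq> S - T"
proof -
  have "p ` (S - T) = p ` S - p ` T"
    using bij_is_inj[OF permutation_bijective[OF assms(1)]] by (rule image_set_diff)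
  then show ?thesis
    using permutation_image_eq[OF assms(1-3)] permutation_image_eq[OF assms(1) _ assms(4)]
      finite_subset[OF assms(5,2)] by auto
qed

text \<open>The swap exchanges the successors of \<open>x\<close> and \<open>y\<close>: a walk from
  \<open>x\<close> enters the cycle of \<open>y\<close>, runs through it up to \<open>y\<close>, and
  only then returns to the cycle of \<open>x\<close>.\<close>

lemma orbit_transpose_disjoint:
  assumes p: "permutation p" and xy: "y \<notin> orbit p x"
  shows "orbit (p \<circ> transpose x y) x = orbit p x \<union> orbit p y"
    and "orbit (p \<circ> transpose x y) y = orbit p x \<union> orbit p y"
proof -
  let ?q = "p \<circ> transpose x y"
  have q: "permutation ?q"
    by (rule permutation_compose[OF p permutation_swap_id])
  have xx: "x \<in> orbit p x" and yy: "y \<in> orbit p y"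
    using permutation_self_in_orbit[OF p] by auto
  have inv: "?q ` (orbit p x \<union> orbit p y) \<subseteq> orbit p x \<union> orbit p y"
    by (intro comp_image_subset transpose_image_subset) (use xx yy in \<open>auto intro: orbit.step\<close>)
  have sub: "orbit ?q z \<subseteq> orbit p x \<union> orbit p y" if "z \<in> {x, y}" for z
    by (rule orbit_subset_invariant[OF inv]) (use xx yy that in auto)
  define T where "T = orbit ?q x"
  have xT: "x \<in> T" unfolding T_def by (rule permutation_self_in_orbit[OF q])
  have qT: "?q z \<in> T" if "z \<in> T" for z
    using that unfolding T_def by (rule orbit.step)
  have yT: "y \<in> T"
  proof -
    \<comment> \<open>The cycle of \<open>y\<close> avoids \<open>x\<close>, so both permutations
      agree along it until \<open>y\<close> itself is met: the walk stays in \<open>T\<close>, or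
      \<open>y\<close> is already in \<open>T\<close>.\<close>
    have "z \<in> T \<or> y \<in> T" if "z \<in> orbit p y" for z
      using that
    proof induction
      case base
      show ?case using qT[OF xT] by simp
    next
      case (step z)
      have "z \<noteq> x"
        using step.hyps orbit_disjoint[OF p xy] xx by auto
      then show ?case
        using step.IH qT[of z] by (cases "z = y") auto
    qed
    from this[OF yy] show ?thesis by simp
  qed
  have pT: "p ` T \<subseteq> T"
  proof
    fix w assume "w \<in> p ` T"
    then obtain z where z: "z \<in> T" "w = p z" by blast
    then have "transpose x y z \<in> T" using xT yT by (auto simp: transpose_def)
    from qT[OF this] show "w \<in> T" using z by simp
  qed
  then have "orbit p x \<union> orbit p y \<subseteq> T"
    using orbit_subset_invariant[OF pT] xT yT by auto
  then show x: "orbit ?q x = orbit p x \<union> orbit p y"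
    using sub[of x] by (auto simp: T_def)
  show "orbit ?q y = orbit p x \<union> orbit p y"
    using orbit_eq_of_mem[OF q] yT x T_def by auto
qed

text \<open>The witness is the arc \<open>p y\<close>, ..., \<open>(p ^^ n) y = x\<close> for the
  least such \<open>n\<close>: after the swap \<open>x\<close> is sent back to \<open>p y\<close>,
  which closes the arc into an invariant set without \<open>y\<close>.\<close>

lemma orbit_transpose_separates:
  assumes p: "permutation p" and xy: "y \<in> orbit p x" "x \<noteq> y"
  shows "y \<notin> orbit (p \<circ> transpose x y) x"
proof -
  let ?q = "p \<circ> transpose x y"
  have "x \<in> orbit p y"
    using orbit_eq_of_mem[OF p xy(1)] permutation_self_in_orbit[OF p] by auto
  then obtain k where k: "(p ^^ k) y = x" "0 < k"
    by (auto simp: orbit_altdef)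
  define n where "n = (LEAST k. 0 < k \<and> (p ^^ k) y = x)"
  have n: "0 < n" "(p ^^ n) y = x"
    using LeastI[of "\<lambda>k. 0 < k \<and> (p ^^ k) y = x" k] k unfolding n_def by auto
  have least: "n \<le> k" if "0 < k" "(p ^^ k) y = x" for k
    unfolding n_def by (rule Least_le) (use that in simp)
  define T where "T = (\<lambda>i. (p ^^ i) y) ` {1..n}"
  \<comment> \<open>A return to \<open>y\<close> inside the arc would give a shorter way from
    \<open>y\<close> to \<open>x\<close>.\<close>
  have ne_y: "(p ^^ i) y \<noteq> y" if "1 \<le> i" "i \<le> n" for i
  proof
    assume eq: "(p ^^ i) y = y"
    have "i < n" using eq n xy(2) that by (cases "i = n") auto
    have "(p ^^ n) y = (p ^^ (n - i)) ((p ^^ i) y)"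
      using \<open>i < n\<close> by (simp flip: funpow_add[THEN fun_cong, unfolded comp_apply])
    then have "(p ^^ (n - i)) y = x"
      using eq n by simp
    then show False
      using least[of "n - i"] \<open>i < n\<close> that by auto
  qed
  have "?q ` T \<subseteq> T"
  proof
    fix w assume "w \<in> ?q ` T"
    then obtain i where i: "1 \<le> i" "i \<le> n" "w = ?q ((p ^^ i) y)"
      by (auto simp: T_def)
    show "w \<in> T"
    proof (cases "i = n")
      case True
      then have "w = (p ^^ 1) y" using i n by simp
      then show ?thesis unfolding T_def using n by (intro image_eqI[of _ _ 1]) auto
    next
      case False
      then have "(p ^^ i) y \<noteq> x" using least[of i] i by auto
      then have "w = (p ^^ Suc i) y"
        using i ne_y[of i] by simp
      then show ?thesis unfolding T_def using i False by (intro image_eqI[of _ _ "Suc i"]) auto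
    qed
  qed
  moreover have "x \<in> T" unfolding T_def using n by (intro image_eqI[of _ _ n]) auto
  ultimately have "orbit ?q x \<subseteq> T" by (rule orbit_subset_invariant)
  moreover have "y \<notin> T" using ne_y unfolding T_def by fastforce
  ultimately show ?thesis by blast
qed

text \<open>Cycles avoiding \<open>x\<close> and \<open>y\<close> are common to both permutations
  and form \<open>R\<close>. Outside \<open>R\<close> there are two cycles before the swap and their
  union after it.\<close>

lemma num_cycles_merge:
  assumes p: "permutation p" and S: "finite S" "p ` S \<subseteq> S" "x \<in> S" "y \<in> S"
    and xy: "y \<notin> orbit p x"
  shows "num_cycles p S = num_cycles (p \<circ> transpose x y) S + 1"
proof -
  let ?q = "p \<circ> transpose x y" and ?X = "orbit p x" and ?Y = "orbit p y"
  define R where "R = orbit p ` (S - (?X \<union> ?Y))"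
  have xx: "x \<in> ?X" and yy: "y \<in> ?Y"
    using permutation_self_in_orbit[OF p] by auto
  have XY: "?X \<subseteq> S" "?Y \<subseteq> S"
    using orbit_subset_invariant[OF S(2)] S by auto
  have q: "permutation ?q"
    by (rule permutation_compose[OF p permutation_swap_id])
  have off: "orbit ?q z = orbit p z" if "z \<notin> ?X \<union> ?Y" for z
  proof (rule orbit_cong)
    show "z \<in> orbit p z" by (rule permutation_self_in_orbit[OF p])
    fix s assume "s \<in> orbit p z"
    then have "s \<noteq> x" "s \<noteq> y"
      using orbit_eq_of_mem[OF p, of s z] permutation_self_in_orbit[OF p, of z] that by auto
    then show "?q s = p s" by simp
  qed
  have on: "orbit ?q z = ?X \<union> ?Y" if "z \<in> ?X \<union> ?Y" for z
    using orbit_transpose_disjoint[OF p xy] orbit_eq_of_mem[OF q, of z] that by auto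
  have split: "S = (S - (?X \<union> ?Y)) \<union> (?X \<union> ?Y)"
    using XY by auto
  have "orbit p ` (?X \<union> ?Y) = {?X, ?Y}"
    by (simp add: image_Un orbit_image_orbit[OF p] insert_commute)
  then have P: "orbit p ` S = insert ?X (insert ?Y R)"
    by (subst split, subst image_Un) (auto simp: R_def)
  have "orbit ?q ` (?X \<union> ?Y) = {?X \<union> ?Y}"
    using on xx by auto
  moreover have "orbit ?q ` (S - (?X \<union> ?Y)) = R"
    unfolding R_def by (rule image_cong) (use off in auto)
  ultimately have Q: "orbit ?q ` S = insert (?X \<union> ?Y) R"
    by (subst split, subst image_Un) auto
  have R: "A \<inter> (?X \<union> ?Y) = {}" "A \<noteq> {}" if AR: "A \<in> R" for A
  proof -
    obtain z where z: "A = orbit p z" "z \<notin> ?X" "z \<notin> ?Y"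
      using AR unfolding R_def by blast
    show "A \<inter> (?X \<union> ?Y) = {}" "A \<noteq> {}"
      using orbit_disjoint[OF p z(2)] orbit_disjoint[OF p z(3)] orbit_nonempty[of p z]
      unfolding z(1) by blast+
  qed
  have "finite R" using S by (simp add: R_def)
  moreover have "?X \<notin> R" "?Y \<notin> R" "?X \<union> ?Y \<notin> R"
    using R xx yy by blast+
  moreover have "?X \<noteq> ?Y" using xy yy by blast
  ultimately show ?thesis
    unfolding num_cycles_def P Q by simp
qed

lemma comp_transpose_transpose: "p \<circ> transpose x y \<circ> transpose x y = p"
  by (simp add: comp_assoc)

text \<open>This is the merging lemma read backwards, applied to
  \<open>p \<circ> transpose x y\<close>, where \<open>x\<close> and \<open>y\<close> are already
  separated.\<close>

lemma num_cycles_split: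
  assumes p: "permutation p" and S: "finite S" "p ` S \<subseteq> S" "x \<in> S" "y \<in> S"
    and xy: "y \<in> orbit p x" "x \<noteq> y"
  shows "num_cycles (p \<circ> transpose x y) S = num_cycles p S + 1"
proof -
  have "(p \<circ> transpose x y) ` S \<subseteq> S"
    using S by (auto simp: transpose_def)
  then show ?thesis
    using num_cycles_merge[OF permutation_compose[OF p permutation_swap_id] S(1) _ S(3,4)
        orbit_transpose_separates[OF p xy]]
    by (simp add: comp_transpose_transpose)
qed

lemma num_cycles_transpose_le:
  assumes p: "permutation p" and S: "finite S" "p ` S \<subseteq> S" "x \<in> S" "y \<in> S" and "x \<noteq> y"
  shows "num_cycles (p \<circ> transpose x y) S \<le> num_cycles p S + 1"
  using num_cycles_merge[OF p S] num_cycles_split[OF p S _ \<open>x \<noteq> y\<close>]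
  by (cases "y \<in> orbit p x") simp_all

lemma num_cycles_Un:
  assumes p: "permutation p" and S: "finite S" "finite T" "p ` S \<subseteq> S" "p ` T \<subseteq> T" "S \<inter> T = {}"
  shows "num_cycles p (S \<union> T) = num_cycles p S + num_cycles p T"
proof -
  have "orbit p ` S \<inter> orbit p ` T = {}"
  proof (rule ccontr)
    assume "orbit p ` S \<inter> orbit p ` T \<noteq> {}"
    then obtain s t where "s \<in> S" "t \<in> T" "orbit p s = orbit p t" by blast
    then have "orbit p s \<subseteq> S \<inter> T"
      using orbit_subset_invariant[OF S(3)] orbit_subset_invariant[OF S(4)] by blast
    then show False using S(5) orbit_nonempty[of p s] by blast
  qed
  then show ?thesis
    unfolding num_cycles_def using S by (simp add: image_Un card_Un_disjoint)
qed

lemma num_cycles_cong: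
  assumes "p ` S \<subseteq> S" "\<And>z. z \<in> S \<Longrightarrow> p z = q z"
  shows "num_cycles p S = num_cycles q S"
proof -
  have "orbit p ` S = orbit q ` S"
    by (rule image_cong) (use orbit_cong_invariant[OF assms(1) _ assms(2)] in auto)
  then show ?thesis by (simp add: num_cycles_def)
qed

lemma num_cycles_orbit:
  assumes "permutation p"
  shows "num_cycles p (orbit p x) = 1"
  by (simp add: num_cycles_def orbit_image_orbit[OF assms])

lemma num_cycles_le_card: "finite S \<Longrightarrow> num_cycles p S \<le> card S"
  unfolding num_cycles_def by (rule card_image_le)

lemma num_cycles_fixed:
  assumes "\<And>z. z \<in> S \<Longrightarrow> p z = z"
  shows "num_cycles p S = card S"
proof -
  have "orbit p ` S = (\<lambda>z. {z}) ` S"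
    by (rule image_cong) (use assms in \<open>auto simp: orbit_eq_singleton_iff\<close>)
  then show ?thesis by (simp add: num_cycles_def card_image)
qed

subsection \<open>Transitivity and Euler's inequality\<close>

text \<open>Connectivity is phrased by closed sets rather than by a generated group. Inverses need
  no mention: for permutations of a finite set, forward closed sets are closed under inverses as
  well. Closed sets can be intersected, united and complemented directly.\<close>

definition transitive_on :: "('a \<Rightarrow> 'a) set \<Rightarrow> 'a set \<Rightarrow> bool" where
  "transitive_on P S \<longleftrightarrow> (\<forall>T\<subseteq>S. T \<noteq> {} \<longrightarrow> (\<forall>p\<in>P. p ` T \<subseteq> T) \<longrightarrow> T = S)"

lemma transitive_onD:
  assumes "transitive_on P S" "T \<subseteq> S" "z \<in> T" "\<And>p. p \<in> P \<Longrightarrow> p ` T \<subseteq> T"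
  shows "T = S"
proof -
  have "T \<noteq> {}" using assms(3) by blast
  moreover have "\<forall>p\<in>P. p ` T \<subseteq> T" using assms(4) by (rule ballI)
  ultimately show ?thesis using assms(1,2) unfolding transitive_on_def by simp
qed

lemma transitive_on_pairD:
  assumes "transitive_on {p, q} S" "T \<subseteq> S" "z \<in> T" "p ` T \<subseteq> T" "q ` T \<subseteq> T"
  shows "T = S"
  by (rule transitive_onD[OF assms(1-3)]) (use assms(4,5) in auto)

lemma transitive_on_cong:
  assumes "\<And>z. z \<in> S \<Longrightarrow> p z = p' z" "\<And>z. z \<in> S \<Longrightarrow> q z = q' z"
  shows "transitive_on {p, q} S \<longleftrightarrow> transitive_on {p', q'} S"
proof -
  have "p ` T = p' ` T" "q ` T = q' ` T" if "T \<subseteq> S" for T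
    using that assms by (auto intro!: image_cong)
  then show ?thesis unfolding transitive_on_def by auto
qed

text \<open>The component is the intersection of all closed sets through \<open>x\<close>. A
  nonempty closed part missing \<open>x\<close> would have a closed complement in it that still
  contains \<open>x\<close>, against minimality.\<close>

lemma ex_component:
  assumes S: "finite S" and P: "\<forall>p\<in>P. permutation p \<and> p ` S \<subseteq> S" and x: "x \<in> S"
  shows "\<exists>C\<subseteq>S. x \<in> C \<and> (\<forall>p\<in>P. p ` C \<subseteq> C) \<and> transitive_on P C \<and>
    (\<forall>T\<subseteq>S. x \<in> T \<longrightarrow> (\<forall>p\<in>P. p ` T \<subseteq> T) \<longrightarrow> C \<subseteq> T)"
proof -
  define C where "C = \<Inter>{T. T \<subseteq> S \<and> x \<in> T \<and> (\<forall>p\<in>P. p ` T \<subseteq> T)}"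
  have min: "C \<subseteq> T" if "T \<subseteq> S" "x \<in> T" "\<forall>p\<in>P. p ` T \<subseteq> T" for T
    using that unfolding C_def by blast
  have CS: "C \<subseteq> S" by (rule min) (use x P in auto)
  have xC: "x \<in> C" unfolding C_def by blast
  have inv: "\<forall>p\<in>P. p ` C \<subseteq> C"
    unfolding C_def by blast
  have "transitive_on P C"
    unfolding transitive_on_def
  proof (intro allI impI)
    fix T assume T: "T \<subseteq> C" "T \<noteq> {}" "\<forall>p\<in>P. p ` T \<subseteq> T"
    show "T = C"
    proof (cases "x \<in> T")
      case True
      then show ?thesis using min[of T] T CS by blast
    next
      case False
      have "C \<subseteq> C - T"
      proof (rule min)
        show "\<forall>p\<in>P. p ` (C - T) \<subseteq> C - T"
        proof
          fix p assume p: "p \<in> P"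
          show "p ` (C - T) \<subseteq> C - T"
            by (rule permutation_image_Diff) (use P inv T p finite_subset[OF CS S] in auto)
        qed
      qed (use CS xC False in auto)
      then show ?thesis using T by blast
    qed
  qed
  then show ?thesis using CS xC inv min by (intro exI[of _ C]) simp
qed

text \<open>The swap can only join the components of \<open>x\<close> and \<open>y\<close>, so their
  union is closed under everything and must be \<open>S\<close>. Were \<open>y\<close> in the
  component of \<open>x\<close>, that component alone would be \<open>S\<close>.\<close>

lemma transitive_on_transpose_cases:
  assumes S: "finite S" and P: "\<forall>p\<in>P. permutation p \<and> p ` S \<subseteq> S"
    and xy: "x \<in> S" "y \<in> S" and tr: "transitive_on (insert (transpose x y) P) S"
    and ntr: "\<not> transitive_on P S"
  shows "\<exists>C D. C \<union> D = S \<and> C \<inter> D = {} \<and> x \<in> C \<and> y \<in> D \<and>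
    (\<forall>p\<in>P. p ` C \<subseteq> C) \<and> (\<forall>p\<in>P. p ` D \<subseteq> D) \<and> transitive_on P C \<and> transitive_on P D"
proof -
  obtain C where C: "C \<subseteq> S" "x \<in> C" "\<forall>p\<in>P. p ` C \<subseteq> C" "transitive_on P C"
    using ex_component[OF S P xy(1)] by metis
  obtain D where D: "D \<subseteq> S" "y \<in> D" "\<forall>p\<in>P. p ` D \<subseteq> D" "transitive_on P D"
    "\<forall>T\<subseteq>S. y \<in> T \<longrightarrow> (\<forall>p\<in>P. p ` T \<subseteq> T) \<longrightarrow> D \<subseteq> T"
    using ex_component[OF S P xy(2)] by metis
  have "y \<notin> C"
  proof
    assume "y \<in> C"
    then have "transpose x y ` C \<subseteq> C"
      using C(2) by (intro transpose_image_subset) simp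
    then have "C = S"
      by (intro transitive_onD[OF tr C(1,2)]) (use C(3) in blast)
    then show False using ntr C(4) by simp
  qed
  \<comment> \<open>The complement of \<open>C\<close> is closed as well, so minimality of
    \<open>D\<close> yields disjointness.\<close>
  have "\<forall>p\<in>P. p ` (S - C) \<subseteq> S - C"
  proof
    fix p assume p: "p \<in> P"
    show "p ` (S - C) \<subseteq> S - C"
      by (rule permutation_image_Diff) (use P C p S in auto)
  qed
  then have "D \<subseteq> S - C"
    using D(5) \<open>y \<notin> C\<close> xy by simp
  have CD: "C \<union> D = S"
  proof (rule transitive_onD[OF tr, of _ x])
    have "transpose x y ` (C \<union> D) \<subseteq> C \<union> D"
      using C(2) D(2) by (intro transpose_image_subset) simp
    moreover have "p ` (C \<union> D) \<subseteq> C \<union> D" if "p \<in> P" for p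
      using that C(3) D(3) by blast
    ultimately show "p ` (C \<union> D) \<subseteq> C \<union> D" if "p \<in> insert (transpose x y) P" for p
      using that by blast
  qed (use C D in auto)
  have "C \<inter> D = {}" using \<open>D \<subseteq> S - C\<close> by blast
  show ?thesis
    by (rule exI[of _ C], rule exI[of _ D], intro conjI) (fact CD C D \<open>C \<inter> D = {}\<close>)+
qed

text \<open>The disjunction serves two situations: Euler's inequality swaps in \<alpha> only,
  whereas cutting a map swaps in both permutations.\<close>

lemma transitive_on_comp_transpose:
  assumes "transitive_on {\<sigma>, \<alpha>} S"
    and "\<sigma> = \<sigma>' \<or> \<sigma> = \<sigma>' \<circ> transpose x y" "\<alpha> = \<alpha>' \<circ> transpose x y"
  shows "transitive_on {transpose x y, \<sigma>', \<alpha>'} S"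
  unfolding transitive_on_def
proof (intro allI impI)
  fix T assume T: "T \<subseteq> S" "T \<noteq> {}" "\<forall>p\<in>{transpose x y, \<sigma>', \<alpha>'}. p ` T \<subseteq> T"
  then have "(f \<circ> transpose x y) ` T \<subseteq> T" if "f ` T \<subseteq> T" for f
    using that by (intro comp_image_subset) auto
  then have "p ` T \<subseteq> T" if "p \<in> {\<sigma>, \<alpha>}" for p
    using that T(3) assms(2,3) by (elim insertE emptyE disjE) (simp_all only:, simp_all)
  then show "T = S"
    using T assms(1) unfolding transitive_on_def by simp
qed

text \<open>Euler's inequality: the genus of a connected triple \<open>(\<sigma>, \<alpha>, \<sigma> \<circ> \<alpha>)\<close> is nonnegative.
  Splitting a cycle of \<open>\<alpha>\<close> by a transposition either keeps the triple connected or cuts it into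
  two components, and then it also cuts a cycle of \<open>\<sigma> \<circ> \<alpha>\<close>.\<close>

lemma euler_inequality:
  assumes "finite S" "permutation \<sigma>" "permutation \<alpha>" "\<sigma> ` S \<subseteq> S" "\<alpha> ` S \<subseteq> S"
    and "transitive_on {\<sigma>, \<alpha>} S"
  shows "num_cycles \<sigma> S + num_cycles \<alpha> S + num_cycles (\<sigma> \<circ> \<alpha>) S \<le> card S + 2"
  using assms
\<comment> \<open>The measure is the number of transpositions needed to write \<alpha> on
  \<open>S\<close>. Splitting a cycle lowers it by one, and its value on a component is at most that
  on the whole set.\<close>
proof (induction "card S - num_cycles \<alpha> S" arbitrary: S \<alpha> rule: less_induct)
  case less
  note S = less.prems(1) and \<sigma> = less.prems(2) and \<alpha> = less.prems(3)
    and inv = less.prems(4,5) and tr = less.prems(6)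
  show ?case
  proof (cases "\<forall>z\<in>S. \<alpha> z = z")
    case True
    \<comment> \<open>With \<alpha> trivial on \<open>S\<close>, the orbits of \<sigma> are already
      closed sets, so connectivity leaves at most one.\<close>
    have "num_cycles \<sigma> S \<le> 1"
    proof (cases "S = {}")
      case True
      then show ?thesis by (simp add: num_cycles_def)
    next
      case False
      then obtain z where z: "z \<in> S" by blast
      have sub: "orbit \<sigma> z \<subseteq> S" by (rule orbit_subset_invariant[OF inv(1) z])
      have "orbit \<sigma> z = S"
      proof (rule transitive_onD[OF tr sub])
        show "z \<in> orbit \<sigma> z" by (rule permutation_self_in_orbit[OF \<sigma>])
        show "p ` orbit \<sigma> z \<subseteq> orbit \<sigma> z" if "p \<in> {\<sigma>, \<alpha>}" for p
          using that True sub by (auto intro: orbit.step)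
      qed
      then show ?thesis using num_cycles_orbit[OF \<sigma>, of z] by simp
    qed
    moreover have "num_cycles (\<sigma> \<circ> \<alpha>) S = num_cycles \<sigma> S"
      by (rule num_cycles_cong) (use True inv in auto)
    moreover have "num_cycles \<alpha> S \<le> card S" by (rule num_cycles_le_card[OF S])
    ultimately show ?thesis by linarith
  next
    case False
    then obtain x where x: "x \<in> S" "\<alpha> x \<noteq> x" by blast
    \<comment> \<open>For this choice \<beta> fixes \<open>y\<close>: a single label is detached
      from its cycle of \<alpha>.\<close>
    define y where "y = \<alpha> x"
    define \<beta> where "\<beta> = \<alpha> \<circ> transpose x y"
    have y: "y \<in> S" "x \<noteq> y" "y \<in> orbit \<alpha> x"
      using x inv by (auto simp: y_def intro: orbit.base)
    have \<beta>: "permutation \<beta>"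
      unfolding \<beta>_def by (rule permutation_compose[OF \<alpha> permutation_swap_id])
    have inv\<beta>: "\<beta> ` S \<subseteq> S"
      using inv x y by (auto simp: \<beta>_def transpose_def)
    have c\<beta>: "num_cycles \<beta> S = num_cycles \<alpha> S + 1"
      unfolding \<beta>_def by (rule num_cycles_split[OF \<alpha> S inv(2) x(1) y(1,3,2)])
    have \<alpha>_eq: "\<alpha> = \<beta> \<circ> transpose x y"
      by (simp add: \<beta>_def comp_transpose_transpose)
    have \<sigma>\<beta>: "permutation (\<sigma> \<circ> \<beta>)" "(\<sigma> \<circ> \<beta>) ` S \<subseteq> S"
      using permutation_compose[OF \<sigma> \<beta>] comp_image_subset[OF inv(1) inv\<beta>] by auto
    have \<sigma>\<alpha>: "\<sigma> \<circ> \<alpha> = \<sigma> \<circ> \<beta> \<circ> transpose x y"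
      by (simp add: \<alpha>_eq comp_assoc)
    have bd: "num_cycles \<beta> S \<le> card S" by (rule num_cycles_le_card[OF S])
    show ?thesis
    proof (cases "transitive_on {\<sigma>, \<beta>} S")
      case True
      have "num_cycles \<sigma> S + num_cycles \<beta> S + num_cycles (\<sigma> \<circ> \<beta>) S \<le> card S + 2"
        by (rule less.hyps) (use S \<sigma> \<beta> inv inv\<beta> True c\<beta> bd in auto)
      moreover have "num_cycles (\<sigma> \<circ> \<alpha>) S \<le> num_cycles (\<sigma> \<circ> \<beta>) S + 1"
        unfolding \<sigma>\<alpha> by (rule num_cycles_transpose_le[OF \<sigma>\<beta>(1) S \<sigma>\<beta>(2) x(1) y(1,2)])
      ultimately show ?thesis using c\<beta> by linarith
    next
      case False
      have P: "\<forall>p\<in>{\<sigma>, \<beta>}. permutation p \<and> p ` S \<subseteq> S"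
        using \<sigma> \<beta> inv inv\<beta> by auto
      have tr2: "transitive_on {transpose x y, \<sigma>, \<beta>} S"
        by (rule transitive_on_comp_transpose[OF tr]) (simp_all add: \<alpha>_eq)
      obtain C D where CD: "C \<union> D = S" "C \<inter> D = {}" "x \<in> C" "y \<in> D"
        "\<forall>p\<in>{\<sigma>, \<beta>}. p ` C \<subseteq> C" "\<forall>p\<in>{\<sigma>, \<beta>}. p ` D \<subseteq> D"
        "transitive_on {\<sigma>, \<beta>} C" "transitive_on {\<sigma>, \<beta>} D"
        using transitive_on_transpose_cases[OF S P x(1) y(1) tr2 False] by metis
      have fin: "finite C" "finite D" using S CD(1) by auto
      have add: "num_cycles p S = num_cycles p C + num_cycles p D"
        if "permutation p" "p ` C \<subseteq> C" "p ` D \<subseteq> D" for p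
        using num_cycles_Un[OF that(1) fin that(2,3) CD(2)] CD(1) by simp
      have inv': "\<sigma> ` C \<subseteq> C" "\<beta> ` C \<subseteq> C" "\<sigma> ` D \<subseteq> D" "\<beta> ` D \<subseteq> D"
        using CD(5,6) by auto
      then have inv'': "(\<sigma> \<circ> \<beta>) ` C \<subseteq> C" "(\<sigma> \<circ> \<beta>) ` D \<subseteq> D"
        by (simp_all only: comp_image_subset)
      have card: "card S = card C + card D"
        using card_Un_disjoint[OF fin CD(2)] CD(1) by simp
      have bds: "num_cycles \<beta> C \<le> card C" "num_cycles \<beta> D \<le> card D"
        using num_cycles_le_card fin by auto
      note a = add[OF \<sigma> inv'(1,3)] add[OF \<beta> inv'(2,4)] add[OF \<sigma>\<beta>(1) inv'']
      have "num_cycles \<sigma> C + num_cycles \<beta> C + num_cycles (\<sigma> \<circ> \<beta>) C \<le> card C + 2"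
        by (rule less.hyps[OF _ fin(1) \<sigma> \<beta> inv'(1,2) CD(7)])
          (use a(2) card bds bd c\<beta> in linarith)
      moreover have "num_cycles \<sigma> D + num_cycles \<beta> D + num_cycles (\<sigma> \<circ> \<beta>) D \<le> card D + 2"
        by (rule less.hyps[OF _ fin(2) \<sigma> \<beta> inv'(3,4) CD(8)])
          (use a(2) card bds bd c\<beta> in linarith)
      \<comment> \<open>The two components together allow an excess of 4 over \<open>card S\<close>.
        One unit is lost because \<beta> has a cycle more than \<alpha>, another because the swap
        joins cycles of \<open>\<sigma> \<circ> \<beta>\<close> lying in different
        components.\<close>
      moreover have "y \<notin> orbit (\<sigma> \<circ> \<beta>) x"
        using orbit_subset_invariant[OF inv''(1) CD(3)] CD(2,4) by auto
      then have "num_cycles (\<sigma> \<circ> \<beta>) S = num_cycles (\<sigma> \<circ> \<alpha>) S + 1"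
        unfolding \<sigma>\<alpha> by (rule num_cycles_merge[OF \<sigma>\<beta>(1) S \<sigma>\<beta>(2) x(1) y(1)])
      ultimately show ?thesis using a card c\<beta> by linarith
    qed
  qed
qed

subsection \<open>Planar pairings\<close>

text \<open>\<open>F\<close> holds the unpaired labels: after a cut, the two ends of the removed
  pair survive as fixed points. The last clause is the coloring, with odd labels for white
  edges.\<close>

definition pairings :: "nat set \<Rightarrow> nat set \<Rightarrow> (nat \<Rightarrow> nat) set" where
  "pairings S F = {\<iota>. \<iota> permutes S \<and> (\<forall>z. \<iota> (\<iota> z) = z) \<and> (\<forall>z\<in>S. \<iota> z = z \<longleftrightarrow> z \<in> F) \<and>
    (\<forall>z\<in>S - F. odd z \<longrightarrow> even (\<iota> z))}"

text \<open>Genus zero in the form \<open>F + E + V = card S + 2\<close>, where unpaired labels count as cycles of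
  \<open>\<iota>\<close>. In this form it survives composing both \<open>\<sigma>\<close> and \<open>\<iota>\<close> with the same transposition.\<close>

definition planar_on :: "nat set \<Rightarrow> (nat \<Rightarrow> nat) \<Rightarrow> (nat \<Rightarrow> nat) \<Rightarrow> bool" where
  "planar_on S \<sigma> \<iota> \<longleftrightarrow> transitive_on {\<sigma>, \<iota>} S \<and>
    num_cycles \<sigma> S + num_cycles \<iota> S + num_cycles (\<sigma> \<circ> \<iota>) S = card S + 2"

definition planar_pairings :: "nat set \<Rightarrow> (nat \<Rightarrow> nat) \<Rightarrow> nat set \<Rightarrow> (nat \<Rightarrow> nat) set" where
  "planar_pairings S \<sigma> F = {\<iota> \<in> pairings S F. planar_on S \<sigma> \<iota>}"

lemma finite_pairings: "finite S \<Longrightarrow> finite (pairings S F)"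
  by (rule finite_subset[OF _ finite_permutations[of S]]) (auto simp: pairings_def)

lemma finite_planar_pairings: "finite S \<Longrightarrow> finite (planar_pairings S \<sigma> F)"
  by (rule finite_subset[OF _ finite_pairings]) (auto simp: planar_pairings_def)

lemma pairings_permutation: "\<iota> \<in> pairings S F \<Longrightarrow> finite S \<Longrightarrow> permutation \<iota>"
  by (auto simp: pairings_def permutation_permutes)

lemma pairings_image: "\<iota> \<in> pairings S F \<Longrightarrow> \<iota> ` S \<subseteq> S"
  by (auto simp: pairings_def permutes_in_image)

lemma planar_on_cong:
  assumes "\<sigma> ` S \<subseteq> S" "\<iota> ` S \<subseteq> S"
    and "\<And>z. z \<in> S \<Longrightarrow> \<sigma> z = \<sigma>' z" "\<And>z. z \<in> S \<Longrightarrow> \<iota> z = \<iota>' z"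
  shows "planar_on S \<sigma> \<iota> \<longleftrightarrow> planar_on S \<sigma>' \<iota>'"
proof -
  have "num_cycles \<sigma> S = num_cycles \<sigma>' S" "num_cycles \<iota> S = num_cycles \<iota>' S"
    by (rule num_cycles_cong; use assms in auto)+
  moreover have "num_cycles (\<sigma> \<circ> \<iota>) S = num_cycles (\<sigma>' \<circ> \<iota>') S"
    by (rule num_cycles_cong[OF comp_image_subset[OF assms(1,2)]])
      (use assms in \<open>auto simp: image_subset_iff\<close>)
  moreover have "transitive_on {\<sigma>, \<iota>} S \<longleftrightarrow> transitive_on {\<sigma>', \<iota>'} S"
    by (rule transitive_on_cong) (use assms in auto)
  ultimately show ?thesis unfolding planar_on_def by simp
qed

subsection \<open>Relabelling\<close>

lemma num_cycles_image:
  assumes p: "permutation p" "p ` S \<subseteq> S" and f: "inj_on f S"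
    and eq: "\<And>z. z \<in> S \<Longrightarrow> p' (f z) = f (p z)"
  shows "num_cycles p' (f ` S) = num_cycles p S"
proof -
  have sub: "orbit p z \<subseteq> S" if "z \<in> S" for z
    by (rule orbit_subset_invariant[OF p(2) that])
  have "orbit p' (f z) = f ` orbit p z" if "z \<in> S" for z
    by (rule orbit_inverse[OF permutation_self_in_orbit[OF p(1)], symmetric])
      (use sub[OF that] eq in auto)
  then have "orbit p' ` f ` S = (\<lambda>A. f ` A) ` orbit p ` S"
    by (simp add: image_image cong: image_cong)
  moreover have "inj_on (\<lambda>A. f ` A) (orbit p ` S)"
  proof (rule inj_on_subset[OF inj_on_image_Pow[OF f]])
    show "orbit p ` S \<subseteq> Pow S" using sub by blast
  qed
  ultimately show ?thesis
    unfolding num_cycles_def by (simp add: card_image)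
qed

text \<open>The preimage under \<open>f\<close> of a closed set is closed.\<close>

lemma transitive_on_image:
  assumes "transitive_on {p, q} S" "p ` S \<subseteq> S" "q ` S \<subseteq> S"
    and "\<And>z. z \<in> S \<Longrightarrow> p' (f z) = f (p z)" "\<And>z. z \<in> S \<Longrightarrow> q' (f z) = f (q z)"
  shows "transitive_on {p', q'} (f ` S)"
  unfolding transitive_on_def
proof (intro allI impI)
  fix T assume T: "T \<subseteq> f ` S" "T \<noteq> {}" "\<forall>r\<in>{p', q'}. r ` T \<subseteq> T"
  define U where "U = {z \<in> S. f z \<in> T}"
  have "p ` U \<subseteq> U" "q ` U \<subseteq> U"
    using assms T(3) by (auto simp: U_def image_subset_iff simp flip: assms(4,5))
  moreover obtain z where "z \<in> U" using T(1,2) by (auto simp: U_def)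
  moreover have "U \<subseteq> S" by (auto simp: U_def)
  ultimately have "U = S"
    using transitive_onD[OF assms(1), of U z] by auto
  then show "T = f ` S" using T(1) by (auto simp: U_def)
qed

text \<open>Conjugation by \<open>f\<close> is the transport: commuting with the face permutations
  keeps cycle counts and connectivity, preserving parity keeps the coloring. An inequality suffices,
  since the inverse of \<open>f\<close> supplies the other one.\<close>

lemma card_planar_pairings_le:
  assumes S: "finite S" and \<sigma>: "permutation \<sigma>" "\<sigma> ` S \<subseteq> S"
    and f: "inj_on f S" "\<And>z. z \<in> S \<Longrightarrow> \<sigma>' (f z) = f (\<sigma> z)" "\<And>z. z \<in> S \<Longrightarrow> even (f z) = even z"
    and F: "F \<subseteq> S"
  shows "card (planar_pairings S \<sigma> F) \<le> card (planar_pairings (f ` S) \<sigma>' (f ` F))"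
proof (rule card_inj_on_le)
  have bij: "bij_betw f S (f ` S)" using f(1) by (rule inj_on_imp_bij_betw)
  show "inj_on (map_permutation S f) (planar_pairings S \<sigma> F)"
  proof (rule inj_onI)
    fix \<iota> \<kappa>
    assume *: "\<iota> \<in> planar_pairings S \<sigma> F" "\<kappa> \<in> planar_pairings S \<sigma> F"
      and eq: "map_permutation S f \<iota> = map_permutation S f \<kappa>"
    have "\<iota> permutes S" "\<kappa> permutes S"
      using * by (auto simp: planar_pairings_def pairings_def)
    then show "\<iota> = \<kappa>"
      using map_permutation_compose_inv[OF bij, of _ "inv_into S f"] f(1) eq
      by (metis inv_into_f_f)
  qed
  show "map_permutation S f ` planar_pairings S \<sigma> F \<subseteq> planar_pairings (f ` S) \<sigma>' (f ` F)"
  proof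
    fix \<kappa> assume "\<kappa> \<in> map_permutation S f ` planar_pairings S \<sigma> F"
    then obtain \<iota> where \<iota>: "\<iota> \<in> pairings S F" "planar_on S \<sigma> \<iota>" and \<kappa>: "\<kappa> = map_permutation S f \<iota>"
      by (auto simp: planar_pairings_def)
    have \<iota>S: "\<iota> permutes S" using \<iota>(1) by (simp add: pairings_def)
    have \<kappa>f: "\<kappa> (f z) = f (\<iota> z)" if "z \<in> S" for z
      unfolding \<kappa> by (rule map_permutation_apply[OF f(1) that])
    have \<kappa>S: "\<kappa> permutes f ` S"
      unfolding \<kappa> by (rule map_permutation_permutes[OF bij \<iota>S])
    have in_S: "\<iota> z \<in> S" if "z \<in> S" for z
      using that \<iota>S by (simp add: permutes_in_image)
    have "\<kappa> (\<kappa> w) = w" for w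
    proof (cases "w \<in> f ` S")
      case True
      then obtain z where "z \<in> S" "w = f z" by blast
      then show ?thesis using \<kappa>f in_S \<iota>(1) by (simp add: pairings_def)
    next
      case False
      then show ?thesis using \<kappa>S by (simp add: permutes_not_in)
    qed
    moreover have "\<kappa> (f z) = f z \<longleftrightarrow> f z \<in> f ` F" if "z \<in> S" for z
    proof -
      have "\<kappa> (f z) = f z \<longleftrightarrow> \<iota> z = z"
        using that \<kappa>f in_S f(1) by (simp add: inj_on_eq_iff)
      moreover have "f z \<in> f ` F \<longleftrightarrow> z \<in> F"
        using that f(1) F by (auto dest: inj_onD)
      ultimately show ?thesis using that \<iota>(1) by (simp add: pairings_def)
    qed
    moreover have "even (\<kappa> (f z))" if "z \<in> S" "f z \<notin> f ` F" "odd (f z)" for z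
      using that \<kappa>f in_S f(3) \<iota>(1) by (auto simp: pairings_def)
    ultimately have 1: "\<kappa> \<in> pairings (f ` S) (f ` F)"
      using \<kappa>S by (auto simp: pairings_def)
    have p\<iota>: "permutation \<iota>" "\<iota> ` S \<subseteq> S"
      using pairings_permutation[OF \<iota>(1) S] pairings_image[OF \<iota>(1)] by auto
    have "num_cycles \<sigma>' (f ` S) = num_cycles \<sigma> S"
      by (rule num_cycles_image[OF \<sigma> f(1,2)])
    moreover have "num_cycles \<kappa> (f ` S) = num_cycles \<iota> S"
      by (rule num_cycles_image[OF p\<iota> f(1) \<kappa>f])
    moreover have "num_cycles (\<sigma>' \<circ> \<kappa>) (f ` S) = num_cycles (\<sigma> \<circ> \<iota>) S"
      by (rule num_cycles_image[OF permutation_compose[OF \<sigma>(1) p\<iota>(1)]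
            comp_image_subset[OF \<sigma>(2) p\<iota>(2)] f(1)]) (simp add: \<kappa>f f(2) in_S)
    moreover have "transitive_on {\<sigma>', \<kappa>} (f ` S)"
      by (rule transitive_on_image[OF _ \<sigma>(2) p\<iota>(2) f(2) \<kappa>f])
        (use \<iota>(2) in \<open>simp_all add: planar_on_def\<close>)
    ultimately have "planar_on (f ` S) \<sigma>' \<kappa>"
      using \<iota>(2) card_image[OF f(1)] by (simp add: planar_on_def)
    with 1 show "\<kappa> \<in> planar_pairings (f ` S) \<sigma>' (f ` F)" by (simp add: planar_pairings_def)
  qed
  show "finite (planar_pairings (f ` S) \<sigma>' (f ` F))"
    by (rule finite_planar_pairings) (use S in simp)
qed

lemma card_planar_pairings_image:
  assumes S: "finite S" and \<sigma>: "permutation \<sigma>" "\<sigma> ` S \<subseteq> S" and \<sigma>': "permutation \<sigma>'"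
    and f: "inj_on f S" "\<And>z. z \<in> S \<Longrightarrow> \<sigma>' (f z) = f (\<sigma> z)" "\<And>z. z \<in> S \<Longrightarrow> even (f z) = even z"
    and F: "F \<subseteq> S"
  shows "card (planar_pairings (f ` S) \<sigma>' (f ` F)) = card (planar_pairings S \<sigma> F)"
proof (rule antisym)
  let ?g = "inv_into S f"
  have gf: "?g (f z) = z" if "z \<in> S" for z using f(1) that by (rule inv_into_f_f)
  have "card (planar_pairings (f ` S) \<sigma>' (f ` F))
      \<le> card (planar_pairings (?g ` f ` S) \<sigma> (?g ` f ` F))"
  proof (rule card_planar_pairings_le[OF _ \<sigma>'])
    show "\<sigma>' ` f ` S \<subseteq> f ` S" using f(2) \<sigma>(2) by (auto simp: image_subset_iff)
    show "inj_on ?g (f ` S)" by (rule inj_on_inv_into) simp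
    show "\<sigma> (?g w) = ?g (\<sigma>' w)" if "w \<in> f ` S" for w
      using that gf f(2) \<sigma>(2) by (auto simp: image_subset_iff)
    show "even (?g w) = even w" if "w \<in> f ` S" for w
      using that gf f(3) by auto
  qed (use S F in auto)
  moreover have "?g ` f ` A = A" if "A \<subseteq> S" for A
    using that gf by (force simp: image_iff)
  ultimately show "card (planar_pairings (f ` S) \<sigma>' (f ` F)) \<le> card (planar_pairings S \<sigma> F)"
    using F by simp
qed (rule card_planar_pairings_le[OF S \<sigma> f F])

subsection \<open>Removing unpaired labels\<close>

lemma num_cycles_remove_fixed:
  assumes "permutation p" "finite S" "p ` S \<subseteq> S" "x \<in> S" "p x = x"
  shows "num_cycles p S = num_cycles p (S - {x}) + 1"
proof -
  have "num_cycles p ((S - {x}) \<union> {x}) = num_cycles p (S - {x}) + num_cycles p {x}"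
    by (rule num_cycles_Un) (use assms permutation_image_Diff[of p S "{x}"] in auto)
  moreover have "S - {x} \<union> {x} = S" using assms(4) by blast
  moreover have "num_cycles p {x} = 1" using num_cycles_fixed[of "{x}" p] assms(5) by simp
  ultimately show ?thesis by simp
qed

text \<open>The swap turns \<open>x\<close> into a fixed point and links its predecessor
  \<open>w\<close> to its successor. Splitting off \<open>{x}\<close> gains a cycle, dropping the
  label loses it again.\<close>

lemma num_cycles_skip:
  assumes p: "permutation p" "finite S" "p ` S \<subseteq> S" and w: "w \<in> S" "p w = x" "w \<noteq> x"
  shows "num_cycles (p \<circ> transpose w x) (S - {x}) = num_cycles p S"
proof -
  have x: "x \<in> S" using p(3) w by auto
  have "x \<in> orbit p w" using w(2) orbit.base[of p w] by simp
  then have "num_cycles (p \<circ> transpose w x) S = num_cycles p S + 1"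
    by (rule num_cycles_split[OF p w(1) x _ w(3)])
  moreover have "num_cycles (p \<circ> transpose w x) S = num_cycles (p \<circ> transpose w x) (S - {x}) + 1"
    by (rule num_cycles_remove_fixed[OF permutation_compose[OF p(1) permutation_swap_id] p(2)
          comp_image_subset[OF p(3) transpose_image_subset] x]) (use w x in auto)
  ultimately show ?thesis by simp
qed

text \<open>Deleting an unpaired label keeps the numbers of faces and vertices. Only the cycle
  \<open>{x}\<close> of \<iota> and the label itself vanish, one on each side of the planarity
  equation. Since \<open>w \<noteq> x\<close>, the face does not vanish with it.\<close>

lemma planar_pairings_remove:
  assumes S: "finite S" and \<sigma>: "permutation \<sigma>" "\<sigma> ` S \<subseteq> S"
    and w: "w \<in> S" "\<sigma> w = x" "w \<noteq> x" and F: "x \<in> F"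
  shows "planar_pairings S \<sigma> F = planar_pairings (S - {x}) (\<sigma> \<circ> transpose w x) (F - {x})"
proof -
  let ?\<sigma> = "\<sigma> \<circ> transpose w x"
  have x: "x \<in> S" using \<sigma>(2) w by auto
  have \<iota>x: "\<iota> x = x" if "\<iota> \<in> pairings S F" for \<iota>
    using that x F by (simp add: pairings_def)
  have eq: "pairings S F = pairings (S - {x}) (F - {x})"
  proof (intro equalityI subsetI)
    fix \<iota> assume \<iota>: "\<iota> \<in> pairings S F"
    then have "\<iota> permutes S" by (simp add: pairings_def)
    then have "\<iota> permutes S - {x}"
      by (rule permutes_superset) (use \<iota>x[OF \<iota>] in auto)
    then show "\<iota> \<in> pairings (S - {x}) (F - {x})"
      using \<iota> by (auto simp: pairings_def)
  next
    fix \<iota> assume \<iota>: "\<iota> \<in> pairings (S - {x}) (F - {x})"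
    then have \<iota>S: "\<iota> permutes S - {x}" by (simp add: pairings_def)
    then have "\<iota> permutes S"
      by (rule permutes_subset) blast
    moreover have "\<iota> x = x" by (rule permutes_not_in[OF \<iota>S]) simp
    ultimately show "\<iota> \<in> pairings S F"
      using \<iota> F by (auto simp: pairings_def)
  qed
  have "planar_on S \<sigma> \<iota> \<longleftrightarrow> planar_on (S - {x}) ?\<sigma> \<iota>" if \<iota>: "\<iota> \<in> pairings S F" for \<iota>
  proof -
    note p\<iota> = pairings_permutation[OF \<iota> S] pairings_image[OF \<iota>]
    have inv: "\<iota> (\<iota> z) = z" for z using \<iota> by (simp add: pairings_def)
    have \<iota>eq: "\<iota> z = x \<longleftrightarrow> z = x" for z using inv \<iota>x[OF \<iota>] by metis
    have "num_cycles ?\<sigma> (S - {x}) = num_cycles \<sigma> S"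
      by (rule num_cycles_skip[OF \<sigma>(1) S \<sigma>(2) w])
    moreover have "num_cycles \<iota> S = num_cycles \<iota> (S - {x}) + 1"
      by (rule num_cycles_remove_fixed[OF p\<iota>(1) S p\<iota>(2) x \<iota>x[OF \<iota>]])
    \<comment> \<open>In \<open>\<sigma> \<circ> \<iota>\<close> the predecessor of \<open>x\<close>
      is \<open>\<iota> w\<close>, because \<iota> is an involution. Bypassing \<open>x\<close>
      there amounts to bypassing it in \<sigma>.\<close>
    moreover have "num_cycles (\<sigma> \<circ> \<iota> \<circ> transpose (\<iota> w) x) (S - {x}) = num_cycles (\<sigma> \<circ> \<iota>) S"
      by (rule num_cycles_skip[OF permutation_compose[OF \<sigma>(1) p\<iota>(1)] S
            comp_image_subset[OF \<sigma>(2) p\<iota>(2)]]) (use p\<iota>(2) inv w \<iota>eq in auto)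
    moreover have "\<sigma> \<circ> \<iota> \<circ> transpose (\<iota> w) x = ?\<sigma> \<circ> \<iota>"
    proof
      fix z show "(\<sigma> \<circ> \<iota> \<circ> transpose (\<iota> w) x) z = (?\<sigma> \<circ> \<iota>) z"
      proof -
        consider "z = \<iota> w" | "z = x" | "z \<noteq> \<iota> w" "z \<noteq> x" by blast
        then show ?thesis
        proof cases
          case 1
          then show ?thesis using inv[of w] \<iota>x[OF \<iota>] by simp
        next
          case 2
          then show ?thesis using inv[of w] \<iota>x[OF \<iota>] by simp
        next
          case 3
          then have "\<iota> z \<noteq> w" "\<iota> z \<noteq> x" using inv[of z] \<iota>eq[of z] by auto
          then show ?thesis using 3 by simp
        qed
      qed
    qed
    moreover have "card S = card (S - {x}) + 1"
      using card.remove[OF S x] by simp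
    moreover have "transitive_on {\<sigma>, \<iota>} S \<longleftrightarrow> transitive_on {?\<sigma>, \<iota>} (S - {x})"
    proof
      assume tr: "transitive_on {\<sigma>, \<iota>} S"
      show "transitive_on {?\<sigma>, \<iota>} (S - {x})"
        unfolding transitive_on_def
      proof (intro allI impI)
        fix T assume T: "T \<subseteq> S - {x}" "T \<noteq> {}" "\<forall>p\<in>{?\<sigma>, \<iota>}. p ` T \<subseteq> T"
        \<comment> \<open>Putting \<open>x\<close> back exactly when its predecessor is present
          makes the set closed under the original \<sigma>.\<close>
        define U where "U = (if w \<in> T then insert x T else T)"
        have "\<sigma> z \<in> U" if z: "z \<in> U" for z
        proof (cases "z = w")
          case True
          then show ?thesis using w z by (auto simp: U_def split: if_splits)
        next
          case zw: False
          show ?thesis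
          proof (cases "z = x")
            case True
            then have "w \<in> T" using z T(1) by (auto simp: U_def split: if_splits)
            then have "?\<sigma> w \<in> T" using T(3) by blast
            then show ?thesis using True by (auto simp: U_def)
          next
            case False
            then have "z \<in> T" using z by (auto simp: U_def split: if_splits)
            then have "?\<sigma> z \<in> T" using T(3) by blast
            then show ?thesis using False zw by (auto simp: U_def)
          qed
        qed
        then have "\<sigma> ` U \<subseteq> U" by (rule image_subsetI)
        moreover have "\<iota> ` U \<subseteq> U"
          using T(3) \<iota>x[OF \<iota>] by (auto simp: U_def)
        moreover obtain u where "u \<in> T" using T(2) by blast
        then have "u \<in> U" by (simp add: U_def)
        moreover have "U \<subseteq> S" using T(1) x by (auto simp: U_def)
        ultimately have "U = S"
          by (intro transitive_on_pairD[OF tr, of U u])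
        then show "T = S - {x}" using T(1) x by (auto simp: U_def split: if_splits)
      qed
    next
      assume tr: "transitive_on {?\<sigma>, \<iota>} (S - {x})"
      show "transitive_on {\<sigma>, \<iota>} S"
        unfolding transitive_on_def
      proof (intro allI impI)
        fix T assume T: "T \<subseteq> S" "T \<noteq> {}" "\<forall>p\<in>{\<sigma>, \<iota>}. p ` T \<subseteq> T"
        have \<sigma>inj: "\<sigma> u = \<sigma> v \<longleftrightarrow> u = v" for u v
          using bij_is_inj[OF permutation_bijective[OF \<sigma>(1)]] by (simp add: inj_eq)
        \<comment> \<open>A closed \<open>{x}\<close> would make \<open>x\<close> a fixed point of
          \<sigma>, but \<open>x\<close> is already the image of \<open>w\<close>.\<close>
        have "T - {x} \<noteq> {}"
        proof
          assume "T - {x} = {}"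
          then have "T = {x}" using T(2) by blast
          then have "\<sigma> x = x" using T(3) by auto
          then show False using w \<sigma>inj by metis
        qed
        then obtain u where u: "u \<in> T - {x}" by blast
        have "?\<sigma> z \<in> T - {x}" if z: "z \<in> T - {x}" for z
        proof (cases "z = w")
          case True
          then have "\<sigma> w \<in> T" using z T(3) by blast
          then have "\<sigma> x \<in> T" using w(2) T(3) by blast
          then show ?thesis using True w \<sigma>inj by (metis DiffI comp_apply singletonD transpose_apply_first)
        next
          case False
          then have "?\<sigma> z = \<sigma> z" using z by simp
          moreover have "\<sigma> z \<noteq> x" using False w(2) \<sigma>inj by metis
          ultimately show ?thesis using z T(3) by auto
        qed
        then have 1: "?\<sigma> ` (T - {x}) \<subseteq> T - {x}" by (rule image_subsetI)
        have 2: "\<iota> ` (T - {x}) \<subseteq> T - {x}"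
          using T(3) \<iota>eq by auto
        have "T - {x} \<subseteq> S - {x}" using T(1) by blast
        then have "T - {x} = S - {x}"
          by (rule transitive_on_pairD[OF tr _ u 1 2])
        then have "w \<in> T" using w by blast
        then have "x \<in> T" using w(2) T(3) by blast
        then show "T = S" using \<open>T - {x} = S - {x}\<close> x by blast
      qed
    qed
    ultimately show ?thesis unfolding planar_on_def by auto
  qed
  then show ?thesis unfolding planar_pairings_def using eq by blast
qed

subsection \<open>Gluing the first pair\<close>

text \<open>The transposition is a cycle of \<iota> and hence commutes with it. This is why swapping
  in both the face permutation and \<iota> leaves the vertex permutation as it was.\<close>

lemma swapped_comp_transpose:
  assumes "\<And>z. \<iota> (\<iota> z) = z" "\<iota> x = y"
  shows "transpose x y \<circ> \<iota> \<circ> transpose x y = \<iota>"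
proof
  fix z
  have yx: "\<iota> y = x" using assms by metis
  consider "z = x" | "z = y" | "z \<noteq> x" "z \<noteq> y" by blast
  then show "(transpose x y \<circ> \<iota> \<circ> transpose x y) z = \<iota> z"
  proof cases
    case 3
    then have "\<iota> z \<noteq> x" "\<iota> z \<noteq> y" using assms by metis+
    then show ?thesis using 3 by simp
  qed (use assms yx in simp_all)
qed

text \<open>For a fixed partner of \<open>x\<close> the cut is reversible. The parities of
  \<open>x\<close> and \<open>y\<close> restore the coloring of the pair when it is glued
  back.\<close>

lemma pairings_unglue:
  assumes xy: "x \<in> S" "y \<in> S" "odd x" "even y"
  shows "\<iota> \<in> pairings S {} \<and> \<iota> x = y \<longleftrightarrow> \<iota> \<circ> transpose x y \<in> pairings S {x, y}"
proof
  let ?\<kappa> = "\<iota> \<circ> transpose x y"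
  assume \<iota>: "\<iota> \<in> pairings S {} \<and> \<iota> x = y"
  then have inv: "\<iota> (\<iota> z) = z" for z by (simp add: pairings_def)
  then have yx: "\<iota> y = x" using \<iota> by metis
  have "?\<kappa> permutes S"
    using \<iota> xy by (intro permutes_compose permutes_swap_id) (auto simp: pairings_def)
  moreover have "?\<kappa> (?\<kappa> z) = z" for z
  proof -
    consider "z = x" | "z = y" | "z \<noteq> x" "z \<noteq> y" by blast
    then show ?thesis
    proof cases
      case 3
      then have "\<iota> z \<noteq> x" "\<iota> z \<noteq> y" using inv \<iota> yx by metis+
      then show ?thesis using 3 inv by simp
    qed (use \<iota> yx in simp_all)
  qed
  moreover have "?\<kappa> z = z \<longleftrightarrow> z \<in> {x, y}" if "z \<in> S" for z
  proof (cases "z = x \<or> z = y")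
    case True
    then show ?thesis using \<iota> yx by auto
  next
    case False
    then show ?thesis using \<iota> that by (simp add: pairings_def)
  qed
  moreover have "even (?\<kappa> z)" if "z \<in> S - {x, y}" "odd z" for z
    using that \<iota> by (simp add: pairings_def)
  ultimately show "?\<kappa> \<in> pairings S {x, y}" by (simp add: pairings_def)
next
  let ?\<kappa> = "\<iota> \<circ> transpose x y"
  assume \<kappa>: "?\<kappa> \<in> pairings S {x, y}"
  have "?\<kappa> x = x" "?\<kappa> y = y"
    using \<kappa> xy unfolding pairings_def by blast+
  then have \<iota>y: "\<iota> y = x" and \<iota>x: "\<iota> x = y" by simp_all
  have inv\<kappa>: "?\<kappa> (?\<kappa> z) = z" for z using \<kappa> unfolding pairings_def by blast
  have "?\<kappa> \<circ> transpose x y permutes S"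
    by (rule permutes_compose[OF permutes_swap_id[OF xy(1,2)]]) (use \<kappa> in \<open>simp add: pairings_def\<close>)
  then have 1: "\<iota> permutes S" by (simp add: comp_transpose_transpose)
  have inj: "\<iota> u = \<iota> v \<longleftrightarrow> u = v" for u v
    using permutes_inj[OF 1] by (simp add: inj_eq)
  have 2: "\<iota> (\<iota> z) = z" for z
  proof -
    consider "z = x" | "z = y" | "z \<noteq> x" "z \<noteq> y" by blast
    then show ?thesis
    proof cases
      case 3
      then have "\<iota> z \<noteq> x" "\<iota> z \<noteq> y" using inj \<iota>x \<iota>y by metis+
      then show ?thesis using 3 inv\<kappa>[of z] by simp
    qed (use \<iota>x \<iota>y in simp_all)
  qed
  have ne: "x \<noteq> y" using xy by blast
  have 3: "\<iota> z \<noteq> z" if "z \<in> S" for z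
  proof (cases "z \<in> {x, y}")
    case True
    then show ?thesis using \<iota>x \<iota>y ne by auto
  next
    case False
    then have "?\<kappa> z \<noteq> z" using \<kappa> that unfolding pairings_def by blast
    then show ?thesis using False by simp
  qed
  have 4: "even (\<iota> z)" if "z \<in> S" "odd z" for z
  proof (cases "z \<in> {x, y}")
    case True
    then show ?thesis using \<iota>x xy that by auto
  next
    case False
    then have "even (?\<kappa> z)" using \<kappa> that unfolding pairings_def by blast
    then show ?thesis using False by simp
  qed
  show "\<iota> \<in> pairings S {} \<and> \<iota> x = y"
    using 1 2 3 4 \<iota>x by (auto simp: pairings_def)
qed

lemma card_unglue: "card {\<iota>. \<iota> \<circ> transpose x y \<in> A} = card A"
proof -
  let ?f = "\<lambda>\<iota>. \<iota> \<circ> transpose x y"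
  have "bij_betw ?f {\<iota>. ?f \<iota> \<in> A} A"
    by (intro bij_betw_byWitness[where f' = ?f] ballI image_subsetI)
      (simp_all only: mem_Collect_eq comp_transpose_transpose)
  then show ?thesis by (rule bij_betw_same_card)
qed

text \<open>\<open>Q\<close> is left open because the two cases lead to different cut maps: one
  sphere if faces merge, two spheres if a face splits.\<close>

lemma planar_pairings_unglue_eq:
  assumes xy: "x \<in> S" "y \<in> S" "odd x" "even y"
    and iff: "\<And>\<iota>. \<iota> \<in> pairings S {} \<Longrightarrow> \<iota> x = y \<Longrightarrow>
      planar_on S \<tau> \<iota> \<longleftrightarrow> Q (\<iota> \<circ> transpose x y)"
  shows "card {\<iota> \<in> planar_pairings S \<tau> {}. \<iota> x = y} = card {\<kappa> \<in> pairings S {x, y}. Q \<kappa>}"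
proof -
  have "{\<iota> \<in> planar_pairings S \<tau> {}. \<iota> x = y} =
      {\<iota>. \<iota> \<circ> transpose x y \<in> {\<kappa> \<in> pairings S {x, y}. Q \<kappa>}}"
    unfolding planar_pairings_def using pairings_unglue[OF xy] iff by blast
  then show ?thesis by (simp only: card_unglue)
qed

lemma num_cycles_glued:
  assumes S: "finite S" "x \<in> S" "y \<in> S" "x \<noteq> y" and \<tau>: "permutation \<tau>" "\<tau> ` S \<subseteq> S"
    and \<iota>: "\<iota> \<in> pairings S {}" "\<iota> x = y"
  defines "\<kappa> \<equiv> \<iota> \<circ> transpose x y"
  shows "num_cycles \<kappa> S = num_cycles \<iota> S + 1"
    and "\<tau> \<circ> transpose x y \<circ> \<kappa> = \<tau> \<circ> \<iota>"
proof -
  have inv: "\<iota> (\<iota> z) = z" for z using \<iota>(1) by (simp add: pairings_def)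
  have "y \<in> orbit \<iota> x" using \<iota>(2) orbit.base[of \<iota> x] by simp
  then show "num_cycles \<kappa> S = num_cycles \<iota> S + 1"
    unfolding \<kappa>_def
    by (rule num_cycles_split[OF pairings_permutation[OF \<iota>(1) S(1)] S(1) pairings_image[OF \<iota>(1)]
          S(2,3) _ S(4)])
  show "\<tau> \<circ> transpose x y \<circ> \<kappa> = \<tau> \<circ> \<iota>"
    using swapped_comp_transpose[of \<iota> x y, OF inv \<iota>(2)] unfolding \<kappa>_def by (simp add: comp_assoc)
qed

lemma invariant_swap_iff:
  assumes "\<iota> x = y" "\<And>z. \<iota> (\<iota> z) = z" "\<iota> ` U \<subseteq> U"
  shows "transpose x y ` U \<subseteq> U"
proof (rule transpose_image_subset)
  have "\<iota> z \<in> U" if "z \<in> U" for z using assms(3) that by blast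
  then show "x \<in> U \<longleftrightarrow> y \<in> U" using assms(1,2) by metis
qed

text \<open>Merging loses a face and cutting the pair gains a cycle of the involution, so the
  planarity equation is unchanged. So is connectivity: \<open>x\<close> and \<open>y\<close> share a
  face after the merge, hence a closed set contains both or neither and is closed under the
  swap.\<close>

lemma card_planar_pairings_merge:
  assumes S: "finite S" "x \<in> S" "y \<in> S" "odd x" "even y" and \<tau>: "permutation \<tau>" "\<tau> ` S \<subseteq> S"
    and sep: "y \<notin> orbit \<tau> x"
  shows "card {\<iota> \<in> planar_pairings S \<tau> {}. \<iota> x = y} =
    card (planar_pairings S (\<tau> \<circ> transpose x y) {x, y})"
  unfolding planar_pairings_def[of S "\<tau> \<circ> transpose x y"]
proof (rule planar_pairings_unglue_eq[OF S(2-5)])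
  let ?t = "transpose x y"
  have ne: "x \<noteq> y" using S by blast
  fix \<iota> assume \<iota>: "\<iota> \<in> pairings S {}" "\<iota> x = y"
  then have inv: "\<iota> (\<iota> z) = z" for z by (simp add: pairings_def)
  note g = num_cycles_glued[OF S(1-3) ne \<tau> \<iota>]
  have c: "num_cycles \<tau> S = num_cycles (\<tau> \<circ> ?t) S + 1"
    by (rule num_cycles_merge[OF \<tau>(1) S(1) \<tau>(2) S(2,3) sep])
  have "transitive_on {\<tau>, \<iota>} S \<longleftrightarrow> transitive_on {\<tau> \<circ> ?t, \<iota> \<circ> ?t} S"
  proof
    assume tr: "transitive_on {\<tau>, \<iota>} S"
    show "transitive_on {\<tau> \<circ> ?t, \<iota> \<circ> ?t} S"
      unfolding transitive_on_def
    proof (intro allI impI)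
      fix U assume U: "U \<subseteq> S" "U \<noteq> {}" "\<forall>p\<in>{\<tau> \<circ> ?t, \<iota> \<circ> ?t}. p ` U \<subseteq> U"
      have q: "permutation (\<tau> \<circ> ?t)" by (rule permutation_compose[OF \<tau>(1) permutation_swap_id])
      have \<sigma>U: "(\<tau> \<circ> ?t) ` U \<subseteq> U" using U(3) by blast
      have oxy: "orbit (\<tau> \<circ> ?t) x = orbit (\<tau> \<circ> ?t) y"
        using orbit_transpose_disjoint[OF \<tau>(1) sep] by simp
      have "x \<in> U \<longleftrightarrow> y \<in> U"
        using orbit_subset_invariant[OF \<sigma>U] oxy permutation_self_in_orbit[OF q] by blast
      then have t: "?t ` U \<subseteq> U" by (rule transpose_image_subset)
      have "\<tau> ` U \<subseteq> U" "\<iota> ` U \<subseteq> U"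
        using comp_image_subset[OF \<sigma>U t] comp_image_subset[of "\<iota> \<circ> ?t" U ?t, OF _ t] U(3)
        by (simp_all add: comp_transpose_transpose)
      moreover obtain u where "u \<in> U" using U(2) by blast
      ultimately show "U = S" using transitive_on_pairD[OF tr U(1)] by blast
    qed
  next
    assume tr: "transitive_on {\<tau> \<circ> ?t, \<iota> \<circ> ?t} S"
    show "transitive_on {\<tau>, \<iota>} S"
      unfolding transitive_on_def
    proof (intro allI impI)
      fix U assume U: "U \<subseteq> S" "U \<noteq> {}" "\<forall>p\<in>{\<tau>, \<iota>}. p ` U \<subseteq> U"
      then have "\<tau> ` U \<subseteq> U" "\<iota> ` U \<subseteq> U" by blast+
      moreover from this have "?t ` U \<subseteq> U"
        by (intro invariant_swap_iff[of \<iota>] \<iota>(2) inv)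
      moreover obtain u where "u \<in> U" using U(2) by blast
      ultimately show "U = S"
        by (intro transitive_on_pairD[OF tr U(1)] comp_image_subset)
    qed
  qed
  then show "planar_on S \<tau> \<iota> \<longleftrightarrow> planar_on S (\<tau> \<circ> ?t) (\<iota> \<circ> ?t)"
    unfolding planar_on_def g c by auto
qed

section \<open>Independent pairings on complementary label sets\<close>

lemma pairings_restrict:
  assumes \<kappa>: "\<kappa> \<in> pairings S F" and T: "T \<subseteq> S" "finite T" "\<kappa> ` T \<subseteq> T"
  shows "restrict_id \<kappa> T \<in> pairings T (F \<inter> T)"
proof -
  have "inj_on \<kappa> T"
    using \<kappa> by (auto simp: pairings_def intro: inj_on_subset[OF permutes_inj])
  then have "bij_betw \<kappa> T T"
    using endo_inj_surj[OF T(2,3)] by (simp add: bij_betw_def)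
  then have "restrict_id \<kappa> T permutes T" by (rule permutes_restrict_id)
  then show ?thesis
    using \<kappa> T by (auto simp: pairings_def restrict_id_def)
qed

lemma pairings_comp_apply:
  assumes "\<kappa> \<in> pairings T F" "\<mu> \<in> pairings U G" "T \<inter> U = {}"
  shows "z \<in> T \<Longrightarrow> (\<kappa> \<circ> \<mu>) z = \<kappa> z" "z \<in> U \<Longrightarrow> (\<kappa> \<circ> \<mu>) z = \<mu> z"
    "z \<notin> T \<union> U \<Longrightarrow> (\<kappa> \<circ> \<mu>) z = z"
proof -
  have p: "\<kappa> permutes T" "\<mu> permutes U" using assms by (auto simp: pairings_def)
  show "(\<kappa> \<circ> \<mu>) z = \<kappa> z" if "z \<in> T"
  proof -
    have "z \<notin> U" using that assms(3) by blast
    then show ?thesis using permutes_not_in[OF p(2), of z] by simp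
  qed
  show "(\<kappa> \<circ> \<mu>) z = \<mu> z" if "z \<in> U"
  proof -
    have "\<mu> z \<in> U" using that p(2) by (simp add: permutes_in_image)
    then have "\<mu> z \<notin> T" using assms(3) by blast
    then show ?thesis using permutes_not_in[OF p(1), of "\<mu> z"] by simp
  qed
  show "(\<kappa> \<circ> \<mu>) z = z" if "z \<notin> T \<union> U"
    using that permutes_not_in[OF p(1), of z] permutes_not_in[OF p(2), of z] by simp
qed

lemma pairings_comp:
  assumes \<kappa>\<mu>: "\<kappa> \<in> pairings T F" "\<mu> \<in> pairings U G" "T \<inter> U = {}" and FG: "F \<subseteq> T" "G \<subseteq> U"
  shows "\<kappa> \<circ> \<mu> \<in> pairings (T \<union> U) (F \<union> G)"
proof -
  note ap = pairings_comp_apply[OF \<kappa>\<mu>]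
  have p: "\<kappa> permutes T" "\<mu> permutes U" using \<kappa>\<mu> by (auto simp: pairings_def)
  have "\<kappa> \<circ> \<mu> permutes T \<union> U"
    by (rule permutes_compose[OF permutes_subset[OF p(2)] permutes_subset[OF p(1)]]) auto
  moreover have "(\<kappa> \<circ> \<mu>) ((\<kappa> \<circ> \<mu>) z) = z" for z
  proof -
    consider "z \<in> T" | "z \<in> U" | "z \<notin> T \<union> U" by blast
    then show ?thesis
    proof cases
      case 1
      then have "\<kappa> z \<in> T" using p(1) by (simp add: permutes_in_image)
      then show ?thesis using ap(1)[OF 1] ap(1)[of "\<kappa> z"] \<kappa>\<mu>(1) by (simp add: pairings_def)
    next
      case 2
      then have "\<mu> z \<in> U" using p(2) by (simp add: permutes_in_image)
      then show ?thesis using ap(2)[OF 2] ap(2)[of "\<mu> z"] \<kappa>\<mu>(2) by (simp add: pairings_def)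
    next
      case 3
      show ?thesis unfolding ap(3)[OF 3] ap(3)[OF 3] ..
    qed
  qed
  moreover have "((\<kappa> \<circ> \<mu>) z = z \<longleftrightarrow> z \<in> F \<union> G) \<and> (z \<notin> F \<union> G \<longrightarrow> odd z \<longrightarrow> even ((\<kappa> \<circ> \<mu>) z))"
    if "z \<in> T \<union> U" for z
  proof (cases "z \<in> T")
    case True
    then have "z \<notin> G" using FG \<kappa>\<mu>(3) by blast
    then show ?thesis unfolding ap(1)[OF True] using \<kappa>\<mu>(1) True by (simp add: pairings_def)
  next
    case False
    then have z: "z \<in> U" "z \<notin> F" using that FG by auto
    then show ?thesis unfolding ap(2)[OF z(1)] using \<kappa>\<mu>(2) by (simp add: pairings_def)
  qed
  ultimately show ?thesis unfolding pairings_def by blast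
qed

text \<open>Restricting to the two parts and composing permutations of disjoint support are inverse
  to each other.\<close>

lemma card_pairings_decompose:
  assumes S: "finite S" and T: "T \<subseteq> S" "x \<in> T" "y \<in> S - T"
    and \<sigma>: "\<sigma> ` T \<subseteq> T" "\<sigma> ` (S - T) \<subseteq> S - T"
  shows "card {\<kappa> \<in> pairings S {x, y}. \<kappa> ` T \<subseteq> T \<and> planar_on T \<sigma> \<kappa> \<and> planar_on (S - T) \<sigma> \<kappa>} =
    card (planar_pairings T \<sigma> {x}) * card (planar_pairings (S - T) \<sigma> {y})" (is "card ?K = _")
proof -
  let ?U = "S - T"
  let ?A = "planar_pairings T \<sigma> {x} \<times> planar_pairings ?U \<sigma> {y}"
  let ?f = "\<lambda>\<kappa>. (restrict_id \<kappa> T, restrict_id \<kappa> ?U)" and ?g = "\<lambda>(\<kappa>, \<mu>). \<kappa> \<circ> \<mu>"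
  have fin: "finite T" "finite ?U" using S T finite_subset by auto
  have SU: "T \<union> ?U = S" "T \<inter> ?U = {}" using T by auto
  have K_U: "\<kappa> ` ?U \<subseteq> ?U" if "\<kappa> \<in> ?K" for \<kappa>
  proof -
    have \<kappa>: "\<kappa> \<in> pairings S {x, y}" "\<kappa> ` T \<subseteq> T" using that by simp_all
    show ?thesis
      by (rule permutation_image_Diff[OF pairings_permutation[OF \<kappa>(1) S] S pairings_image[OF \<kappa>(1)]
            \<kappa>(2) T(1)])
  qed
  have "bij_betw ?f ?K ?A"
  proof (rule bij_betw_byWitness[where f' = ?g])
    show "\<forall>\<kappa>\<in>?K. ?g (?f \<kappa>) = \<kappa>"
    proof
      fix \<kappa> assume \<kappa>: "\<kappa> \<in> ?K"
      have "\<kappa> permutes S" using \<kappa> by (simp add: pairings_def)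
      then have off: "\<kappa> z = z" if "z \<notin> S" for z using that by (rule permutes_not_in)
      have "restrict_id \<kappa> T (restrict_id \<kappa> ?U z) = \<kappa> z" for z
        using K_U[OF \<kappa>] off by (auto simp: restrict_id_def image_subset_iff)
      then show "?g (?f \<kappa>) = \<kappa>" by auto
    qed
    show "\<forall>a\<in>?A. ?f (?g a) = a"
    proof
      fix a assume "a \<in> ?A"
      then obtain \<kappa> \<mu> where a: "a = (\<kappa>, \<mu>)" and *: "\<kappa> \<in> pairings T {x}" "\<mu> \<in> pairings ?U {y}"
        by (auto simp: planar_pairings_def)
      note ap = pairings_comp_apply[OF * SU(2)]
      have "restrict_id (\<kappa> \<circ> \<mu>) T = \<kappa>"
        using ap * by (auto simp: restrict_id_def fun_eq_iff pairings_def permutes_not_in)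
      moreover have "restrict_id (\<kappa> \<circ> \<mu>) ?U = \<mu>"
      proof
        fix z
        have "\<mu> permutes ?U" using * by (simp add: pairings_def)
        then show "restrict_id (\<kappa> \<circ> \<mu>) ?U z = \<mu> z"
          using ap(2)[of z] permutes_not_in[of \<mu> ?U z] by (cases "z \<in> ?U") (auto simp: restrict_id_def)
      qed
      ultimately show "?f (?g a) = a" by (simp add: a)
    qed
    show "?f ` ?K \<subseteq> ?A"
    proof (rule image_subsetI)
      fix \<kappa> assume \<kappa>: "\<kappa> \<in> ?K"
      then have kp: "\<kappa> \<in> pairings S {x, y}" "\<kappa> ` T \<subseteq> T" by auto
      have "restrict_id \<kappa> T \<in> pairings T ({x, y} \<inter> T)" "restrict_id \<kappa> ?U \<in> pairings ?U ({x, y} \<inter> ?U)"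
        by (rule pairings_restrict[OF kp(1) T(1) fin(1) kp(2)],
            rule pairings_restrict[OF kp(1) _ fin(2) K_U[OF \<kappa>]]) blast
      moreover have "{x, y} \<inter> T = {x}" "{x, y} \<inter> ?U = {y}" using T by auto
      moreover have "planar_on T \<sigma> \<kappa> \<longleftrightarrow> planar_on T \<sigma> (restrict_id \<kappa> T)"
        by (rule planar_on_cong[OF \<sigma>(1) kp(2)]) (simp_all add: restrict_id_def)
      moreover have "planar_on ?U \<sigma> \<kappa> \<longleftrightarrow> planar_on ?U \<sigma> (restrict_id \<kappa> ?U)"
        by (rule planar_on_cong[OF \<sigma>(2) K_U[OF \<kappa>]]) (simp_all add: restrict_id_def)
      ultimately show "?f \<kappa> \<in> ?A"
        using \<kappa> by (simp add: planar_pairings_def)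
    qed
    show "?g ` ?A \<subseteq> ?K"
    proof (rule image_subsetI)
      fix a assume "a \<in> ?A"
      then obtain \<kappa> \<mu> where a: "a = (\<kappa>, \<mu>)" and *: "\<kappa> \<in> pairings T {x}" "\<mu> \<in> pairings ?U {y}"
        and pl: "planar_on T \<sigma> \<kappa>" "planar_on ?U \<sigma> \<mu>"
        by (auto simp: planar_pairings_def)
      note ap = pairings_comp_apply[OF * SU(2)]
      have "\<kappa> \<circ> \<mu> \<in> pairings (T \<union> ?U) ({x} \<union> {y})"
        by (rule pairings_comp[OF * SU(2)]) (use T in auto)
      then have 1: "\<kappa> \<circ> \<mu> \<in> pairings S {x, y}"
        using SU(1) by (simp add: insert_commute)
      have "\<kappa> ` T \<subseteq> T" by (rule pairings_image[OF *(1)])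
      then have 2: "(\<kappa> \<circ> \<mu>) ` T \<subseteq> T" using ap(1) by (simp add: image_subset_iff)
      have "planar_on T \<sigma> \<kappa> \<longleftrightarrow> planar_on T \<sigma> (\<kappa> \<circ> \<mu>)"
        by (rule planar_on_cong[OF \<sigma>(1) pairings_image[OF *(1)] refl ap(1)[symmetric]])
      moreover have "planar_on ?U \<sigma> \<mu> \<longleftrightarrow> planar_on ?U \<sigma> (\<kappa> \<circ> \<mu>)"
        by (rule planar_on_cong[OF \<sigma>(2) pairings_image[OF *(2)] refl ap(2)[symmetric]])
      ultimately show "?g a \<in> ?K" using 1 2 pl by (simp add: a)
    qed
  qed
  then show ?thesis using bij_betw_same_card by (simp flip: card_cartesian_product)
qed

text \<open>If \<open>x\<close> and \<open>y\<close> lie on the same face, gluing them pinches the surface: the cut map has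
  Euler characteristic \<open>4\<close> and so, by Euler's inequality, consists of two spheres.\<close>

lemma planar_on_glue_iff:
  assumes S: "finite S" "x \<in> S" "y \<in> S" "x \<noteq> y" and \<tau>: "permutation \<tau>" "\<tau> ` S \<subseteq> S"
    and same: "y \<in> orbit \<tau> x" and \<iota>: "\<iota> \<in> pairings S {}" "\<iota> x = y"
  defines "\<sigma> \<equiv> \<tau> \<circ> transpose x y" and "\<kappa> \<equiv> \<iota> \<circ> transpose x y"
  shows "planar_on S \<tau> \<iota> \<longleftrightarrow> (\<exists>T\<subseteq>S. \<sigma> ` T \<subseteq> T \<and> x \<in> T \<and> y \<notin> T \<and>
    \<kappa> ` T \<subseteq> T \<and> planar_on T \<sigma> \<kappa> \<and> planar_on (S - T) \<sigma> \<kappa>)"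
proof -
  let ?t = "transpose x y"
  have inv: "\<iota> (\<iota> z) = z" for z using \<iota> by (simp add: pairings_def)
  have tS: "?t ` S \<subseteq> S" by (rule transpose_image_subset) (use S in simp)
  have \<sigma>: "permutation \<sigma>" "\<sigma> ` S \<subseteq> S"
    unfolding \<sigma>_def by (rule permutation_compose[OF \<tau>(1) permutation_swap_id], rule comp_image_subset[OF \<tau>(2) tS])
  have \<kappa>: "permutation \<kappa>" "\<kappa> ` S \<subseteq> S"
    unfolding \<kappa>_def by (rule permutation_compose[OF pairings_permutation[OF \<iota>(1) S(1)] permutation_swap_id],
      rule comp_image_subset[OF pairings_image[OF \<iota>(1)] tS])
  have \<tau>\<iota>: "\<tau> = \<sigma> \<circ> ?t" "\<iota> = \<kappa> \<circ> ?t"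
    unfolding \<sigma>_def \<kappa>_def by (simp_all only: comp_transpose_transpose)
  note g = num_cycles_glued[OF S \<tau> \<iota>, folded \<sigma>_def \<kappa>_def]
  have c: "num_cycles \<sigma> S = num_cycles \<tau> S + 1"
    unfolding \<sigma>_def by (rule num_cycles_split[OF \<tau>(1) S(1) \<tau>(2) S(2,3) same S(4)])
  have add: "num_cycles p S = num_cycles p T + num_cycles p (S - T)"
    if "permutation p" "p ` S \<subseteq> S" "p ` T \<subseteq> T" "T \<subseteq> S" for p T
  proof -
    have "num_cycles p (T \<union> (S - T)) = num_cycles p T + num_cycles p (S - T)"
      by (rule num_cycles_Un[OF that(1) finite_subset[OF that(4) S(1)] _ that(3)
            permutation_image_Diff[OF that(1) S(1) that(2,3,4)]]) (use S in auto)
    then show ?thesis using that(4) by (simp add: Un_absorb1)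
  qed
  have adds: "num_cycles \<sigma> S = num_cycles \<sigma> T + num_cycles \<sigma> (S - T)"
      "num_cycles \<kappa> S = num_cycles \<kappa> T + num_cycles \<kappa> (S - T)"
      "num_cycles (\<sigma> \<circ> \<kappa>) S = num_cycles (\<sigma> \<circ> \<kappa>) T + num_cycles (\<sigma> \<circ> \<kappa>) (S - T)"
      "card S = card T + card (S - T)"
    if T: "T \<subseteq> S" "\<sigma> ` T \<subseteq> T" "\<kappa> ` T \<subseteq> T" for T
    using add[OF \<sigma> T(2,1)] add[OF \<kappa> T(3,1)]
      add[OF permutation_compose[OF \<sigma>(1) \<kappa>(1)] comp_image_subset[OF \<sigma>(2) \<kappa>(2)]
        comp_image_subset[OF T(2,3)] T(1)]
      card_Diff_subset[OF finite_subset[OF T(1) S(1)] T(1)] card_mono[OF S(1) T(1)]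
    by simp_all
  show ?thesis
  proof
    assume pl: "planar_on S \<tau> \<iota>"
    then have sum: "num_cycles \<sigma> S + num_cycles \<kappa> S + num_cycles (\<sigma> \<circ> \<kappa>) S = card S + 4"
      unfolding planar_on_def g c by simp
    then have ntr: "\<not> transitive_on {\<sigma>, \<kappa>} S"
      using euler_inequality[OF S(1) \<sigma>(1) \<kappa>(1) \<sigma>(2) \<kappa>(2)] by auto
    have "transitive_on {\<tau>, \<iota>} S" using pl by (simp add: planar_on_def)
    then have tr: "transitive_on {?t, \<sigma>, \<kappa>} S"
      by (rule transitive_on_comp_transpose) (use \<tau>\<iota> in blast)+
    have P: "\<forall>p\<in>{\<sigma>, \<kappa>}. permutation p \<and> p ` S \<subseteq> S" using \<sigma> \<kappa> by simp
    obtain T U where TU: "T \<union> U = S" "T \<inter> U = {}" "x \<in> T" "y \<in> U"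
      "\<forall>p\<in>{\<sigma>, \<kappa>}. p ` T \<subseteq> T" "\<forall>p\<in>{\<sigma>, \<kappa>}. p ` U \<subseteq> U"
      "transitive_on {\<sigma>, \<kappa>} T" "transitive_on {\<sigma>, \<kappa>} U"
      using transitive_on_transpose_cases[OF S(1) P S(2,3) tr ntr] by metis
    have U: "U = S - T" using TU(1,2) by blast
    have TS: "T \<subseteq> S" using TU(1) by blast
    have T: "T \<subseteq> S" "\<sigma> ` T \<subseteq> T" "\<kappa> ` T \<subseteq> T" "\<sigma> ` (S - T) \<subseteq> S - T" "\<kappa> ` (S - T) \<subseteq> S - T"
      using TS TU(5,6) unfolding U by simp_all
    have fin: "finite T" "finite (S - T)" using S(1) T(1) finite_subset by auto
    \<comment> \<open>Each part exceeds its number of labels by at most 2. The total excess is 4, so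
      both bounds are attained.\<close>
    have "planar_on T \<sigma> \<kappa> \<and> planar_on (S - T) \<sigma> \<kappa>"
      using adds[OF T(1-3)] sum TU(7,8) euler_inequality[OF fin(1) \<sigma>(1) \<kappa>(1) T(2,3)]
        euler_inequality[OF fin(2) \<sigma>(1) \<kappa>(1) T(4,5)]
      unfolding planar_on_def U by linarith
    moreover have "y \<notin> T" using TU(2,4) by blast
    ultimately show "\<exists>T\<subseteq>S. \<sigma> ` T \<subseteq> T \<and> x \<in> T \<and> y \<notin> T \<and>
        \<kappa> ` T \<subseteq> T \<and> planar_on T \<sigma> \<kappa> \<and> planar_on (S - T) \<sigma> \<kappa>"
      using T(1-3) TU(3) by (intro exI[of _ T]) simp
  next
    assume "\<exists>T\<subseteq>S. \<sigma> ` T \<subseteq> T \<and> x \<in> T \<and> y \<notin> T \<and>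
        \<kappa> ` T \<subseteq> T \<and> planar_on T \<sigma> \<kappa> \<and> planar_on (S - T) \<sigma> \<kappa>"
    then obtain T where T: "T \<subseteq> S" "\<sigma> ` T \<subseteq> T" "\<kappa> ` T \<subseteq> T" "x \<in> T" "y \<notin> T"
      and pl: "planar_on T \<sigma> \<kappa>" "planar_on (S - T) \<sigma> \<kappa>" by metis
    have inv2: "\<sigma> ` (S - T) \<subseteq> S - T" "\<kappa> ` (S - T) \<subseteq> S - T"
      by (rule permutation_image_Diff[OF \<sigma>(1) S(1) \<sigma>(2) T(2,1)],
          rule permutation_image_Diff[OF \<kappa>(1) S(1) \<kappa>(2) T(3,1)])
    have "transitive_on {\<tau>, \<iota>} S"
      unfolding transitive_on_def
    proof (intro allI impI)
      fix U assume U: "U \<subseteq> S" "U \<noteq> {}" "\<forall>p\<in>{\<tau>, \<iota>}. p ` U \<subseteq> U"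
      then have \<iota>U: "\<iota> ` U \<subseteq> U" and \<tau>U: "\<tau> ` U \<subseteq> U" by simp_all
      have tU: "?t ` U \<subseteq> U" by (rule invariant_swap_iff[OF \<iota>(2) inv \<iota>U])
      have \<sigma>\<kappa>U: "\<sigma> ` U \<subseteq> U" "\<kappa> ` U \<subseteq> U"
        unfolding \<sigma>_def \<kappa>_def by (rule comp_image_subset[OF \<tau>U tU], rule comp_image_subset[OF \<iota>U tU])
      \<comment> \<open>A closed set meeting a connected part contains it. The pair
        \<open>x\<close>, \<open>y\<close> then carries it over to the other part.\<close>
      have part: "V \<subseteq> U" if "planar_on V \<sigma> \<kappa>" "\<sigma> ` V \<subseteq> V" "\<kappa> ` V \<subseteq> V" "u \<in> V" "u \<in> U" for V u
      proof -
        have "U \<inter> V = V"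
          by (rule transitive_on_pairD[of \<sigma> \<kappa> V "U \<inter> V" u])
            (use that \<sigma>\<kappa>U in \<open>auto simp: planar_on_def\<close>)
        then show ?thesis by blast
      qed
      obtain u where u: "u \<in> U" using U(2) by blast
      have "x \<in> U \<longleftrightarrow> y \<in> U"
        using \<iota>U \<iota>(2) inv[of x] by (metis image_subset_iff)
      moreover have "x \<in> U \<or> y \<in> U"
      proof (cases "u \<in> T")
        case True
        from part[OF pl(1) T(2,3) True u] T(4) show ?thesis by blast
      next
        case False
        then have "u \<in> S - T" using u U(1) by blast
        from part[OF pl(2) inv2 this u] T(5) S(3) show ?thesis by blast
      qed
      ultimately have "x \<in> U" "y \<in> U" by blast+
      then show "U = S"
        using part[OF pl(1) T(2,3,4)] part[OF pl(2) inv2, of y] T(5) S(3) U(1) by blast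
    qed
    moreover have "num_cycles \<sigma> S + num_cycles \<kappa> S + num_cycles (\<sigma> \<circ> \<kappa>) S = card S + 4"
      using adds[OF T(1-3)] pl unfolding planar_on_def by linarith
    then have "num_cycles \<tau> S + num_cycles \<iota> S + num_cycles (\<tau> \<circ> \<iota>) S = card S + 2"
      unfolding g c by simp
    ultimately show "planar_on S \<tau> \<iota>" unfolding planar_on_def by blast
  qed
qed

text \<open>\<open>T\<close> is determined by the cut pairing, as the component of \<open>x\<close>.
  So the families belonging to different \<open>T\<close> are disjoint and their cardinalities add
  up.\<close>

lemma card_planar_pairings_split:
  assumes S: "finite S" "x \<in> S" "y \<in> S" "odd x" "even y" and \<tau>: "permutation \<tau>" "\<tau> ` S \<subseteq> S"
    and same: "y \<in> orbit \<tau> x"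
  defines "\<sigma> \<equiv> \<tau> \<circ> transpose x y"
  defines "\<T> \<equiv> {T. T \<subseteq> S \<and> \<sigma> ` T \<subseteq> T \<and> x \<in> T \<and> y \<notin> T}"
  shows "card {\<iota> \<in> planar_pairings S \<tau> {}. \<iota> x = y} =
    (\<Sum>T\<in>\<T>. card (planar_pairings T \<sigma> {x}) * card (planar_pairings (S - T) \<sigma> {y}))"
proof -
  define K where "K = (\<lambda>T. {\<kappa> \<in> pairings S {x, y}. \<kappa> ` T \<subseteq> T \<and>
    planar_on T \<sigma> \<kappa> \<and> planar_on (S - T) \<sigma> \<kappa>})"
  have ne: "x \<noteq> y" using S by blast
  have \<sigma>: "permutation \<sigma>" "\<sigma> ` S \<subseteq> S"
    unfolding \<sigma>_def
    by (rule permutation_compose[OF \<tau>(1) permutation_swap_id],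
        rule comp_image_subset[OF \<tau>(2) transpose_image_subset]) (use S in simp)
  have "card {\<iota> \<in> planar_pairings S \<tau> {}. \<iota> x = y} =
      card {\<kappa> \<in> pairings S {x, y}. \<exists>T\<subseteq>S. \<sigma> ` T \<subseteq> T \<and> x \<in> T \<and> y \<notin> T \<and>
        \<kappa> ` T \<subseteq> T \<and> planar_on T \<sigma> \<kappa> \<and> planar_on (S - T) \<sigma> \<kappa>}"
    unfolding \<sigma>_def
    by (rule planar_pairings_unglue_eq[OF S(2-5)]) (rule planar_on_glue_iff[OF S(1-3) ne \<tau> same])
  also have "{\<kappa> \<in> pairings S {x, y}. \<exists>T\<subseteq>S. \<sigma> ` T \<subseteq> T \<and> x \<in> T \<and> y \<notin> T \<and>
        \<kappa> ` T \<subseteq> T \<and> planar_on T \<sigma> \<kappa> \<and> planar_on (S - T) \<sigma> \<kappa>} = (\<Union>T\<in>\<T>. K T)"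
    unfolding K_def \<T>_def by blast
  also have "card \<dots> = (\<Sum>T\<in>\<T>. card (K T))"
  proof (rule card_UN_disjoint)
    show "finite \<T>" unfolding \<T>_def using S(1) by simp
    show "\<forall>T\<in>\<T>. finite (K T)" unfolding K_def using finite_pairings[OF S(1)] by simp
    show "\<forall>T\<in>\<T>. \<forall>T'\<in>\<T>. T \<noteq> T' \<longrightarrow> K T \<inter> K T' = {}"
    proof (intro ballI impI, rule ccontr)
      fix T T' assume T: "T \<in> \<T>" "T' \<in> \<T>" "T \<noteq> T'" "K T \<inter> K T' \<noteq> {}"
      then obtain \<kappa> where \<kappa>: "\<kappa> \<in> K T" "\<kappa> \<in> K T'" by blast
      \<comment> \<open>The intersection is closed and contains \<open>x\<close>, so it fills each
        of the two connected sets.\<close>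
      have "T \<inter> T' = A" if "A \<in> {T, T'}" for A
        by (rule transitive_on_pairD[of \<sigma> \<kappa> A _ x])
          (use that \<kappa> T(1,2) in \<open>auto simp: K_def \<T>_def planar_on_def\<close>)
      then show False using T(3) by blast
    qed
  qed
  also have "\<dots> = (\<Sum>T\<in>\<T>. card (planar_pairings T \<sigma> {x}) * card (planar_pairings (S - T) \<sigma> {y}))"
  proof (rule sum.cong[OF refl])
    fix T assume "T \<in> \<T>"
    then have T: "T \<subseteq> S" "\<sigma> ` T \<subseteq> T" "x \<in> T" "y \<in> S - T" using S(3) by (auto simp: \<T>_def)
    show "card (K T) = card (planar_pairings T \<sigma> {x}) * card (planar_pairings (S - T) \<sigma> {y})"
      unfolding K_def
      by (rule card_pairings_decompose[OF S(1) T(1,3,4,2)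
            permutation_image_Diff[OF \<sigma>(1) S(1) \<sigma>(2) T(2,1)]])
  qed
  finally show ?thesis .
qed

subsection \<open>Faces as lists\<close>

definition traverses :: "(nat \<Rightarrow> nat) \<Rightarrow> nat list \<Rightarrow> bool" where
  "traverses \<sigma> xs \<longleftrightarrow> distinct xs \<and> map \<sigma> xs = rotate1 xs"

lemma traverses_append_commute:
  assumes "traverses \<sigma> (xs @ ys)"
  shows "traverses \<sigma> (ys @ xs)"
proof -
  have "map \<sigma> (rotate (length xs) (xs @ ys)) = rotate1 (rotate (length xs) (xs @ ys))"
    using assms by (simp only: traverses_def flip: rotate_map) (simp add: rotate1_rotate_swap)
  then show ?thesis using assms by (auto simp: traverses_def rotate_append)
qed

lemma traverses_image: "traverses \<sigma> xs \<Longrightarrow> \<sigma> ` set xs = set xs"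
  by (metis traverses_def set_map set_rotate1)

lemma traverses_orbit:
  assumes "traverses \<sigma> xs" "x \<in> set xs"
  shows "orbit \<sigma> x = set xs"
proof
  show "orbit \<sigma> x \<subseteq> set xs"
    using traverses_image[OF assms(1)] assms(2) by (intro orbit_subset_invariant) auto
  obtain us vs where xs: "xs = us @ x # vs" using split_list[OF assms(2)] by blast
  define zs where "zs = vs @ us"
  have tr: "traverses \<sigma> (x # zs)"
    using traverses_append_commute[of \<sigma> us "x # vs"] assms(1) by (simp add: xs zs_def)
  then have m: "map \<sigma> (x # zs) = zs @ [x]" by (simp add: traverses_def)
  have step: "\<sigma> ((x # zs) ! k) = (zs @ [x]) ! k" if "k < length (x # zs)" for k
    using that nth_map[of k "x # zs" \<sigma>] by (simp only: m)
  have "(zs @ [x]) ! k \<in> orbit \<sigma> x" if "k < length (x # zs)" for k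
    using that
  proof (induction k)
    case 0
    then show ?case using step[of 0] orbit.base[of \<sigma> x] by simp
  next
    case (Suc k)
    then have "\<sigma> ((zs @ [x]) ! k) \<in> orbit \<sigma> x" by (intro orbit.step) simp
    moreover have "(zs @ [x]) ! k = (x # zs) ! Suc k" using Suc.prems by (simp add: nth_append)
    ultimately show ?case using step[OF Suc.prems] by simp
  qed
  then have "set (zs @ [x]) \<subseteq> orbit \<sigma> x"
    by (metis in_set_conv_nth length_append_singleton length_Cons subsetI)
  then show "set xs \<subseteq> orbit \<sigma> x" by (auto simp: xs zs_def)
qed

lemma traverses_cong:
  assumes "traverses \<sigma> xs" "\<And>z. z \<in> set xs \<Longrightarrow> \<sigma>' z = \<sigma> z"
  shows "traverses \<sigma>' xs"
  using assms map_cong[of xs xs \<sigma>' \<sigma>] by (simp add: traverses_def)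

lemma map_comp_transpose:
  assumes "x \<notin> set xs" "y \<notin> set xs"
  shows "map (\<tau> \<circ> transpose x y) xs = map \<tau> xs"
  by (rule map_cong[OF refl]) (use assms in \<open>metis comp_apply transpose_apply_other\<close>)

text \<open>The swap gives \<open>x\<close> the old successor of \<open>y\<close> and conversely, so
  each of the two arcs closes up.\<close>

lemma traverses_split:
  assumes "traverses \<tau> (x # us @ y # vs)"
  shows "traverses (\<tau> \<circ> transpose x y) (x # vs)" "traverses (\<tau> \<circ> transpose x y) (y # us)"
proof -
  \<comment> \<open>The first blocks on both sides have equal length, so the equation can be cut
    there.\<close>
  have "(\<tau> x # map \<tau> us) @ (\<tau> y # map \<tau> vs) = (us @ [y]) @ (vs @ [x])"
    using assms by (simp add: traverses_def)
  then have eq: "\<tau> x # map \<tau> us = us @ [y] \<and> \<tau> y # map \<tau> vs = vs @ [x]"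
    by (subst (asm) append_eq_append_conv) simp_all
  have d: "distinct (x # vs)" "distinct (y # us)" "x \<notin> set us" "y \<notin> set vs"
    using assms by (auto simp: traverses_def)
  then have m: "map (\<tau> \<circ> transpose x y) vs = map \<tau> vs" "map (\<tau> \<circ> transpose x y) us = map \<tau> us"
    by (simp_all only: map_comp_transpose distinct.simps not_False_eq_True)
  show "traverses (\<tau> \<circ> transpose x y) (x # vs)" "traverses (\<tau> \<circ> transpose x y) (y # us)"
    using d eq by (simp_all only: traverses_def list.map m) simp_all
qed

lemma traverses_merge:
  assumes "traverses \<tau> (x # us)" "traverses \<tau> (y # vs)" "set (x # us) \<inter> set (y # vs) = {}"
  shows "traverses (\<tau> \<circ> transpose x y) (x # vs @ y # us)"
proof -
  have eq: "\<tau> x # map \<tau> us = us @ [x]" "\<tau> y # map \<tau> vs = vs @ [y]"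
    using assms by (simp_all add: traverses_def)
  have d: "distinct (x # us)" "distinct (y # vs)" "x \<notin> set vs" "y \<notin> set us"
    using assms by (auto simp: traverses_def)
  then have m: "map (\<tau> \<circ> transpose x y) vs = map \<tau> vs" "map (\<tau> \<circ> transpose x y) us = map \<tau> us"
    by (simp_all only: map_comp_transpose distinct.simps not_False_eq_True)
  have "map (\<tau> \<circ> transpose x y) (x # vs @ y # us) = (\<tau> y # map \<tau> vs) @ (\<tau> x # map \<tau> us)"
    by (simp only: list.map map_append m) simp
  then have "map (\<tau> \<circ> transpose x y) (x # vs @ y # us) = rotate1 (x # vs @ y # us)"
    unfolding eq by simp
  moreover have "distinct (x # vs @ y # us)" using d assms(3) by auto
  ultimately show ?thesis by (simp only: traverses_def)
qed

text \<open>\<open>F\<close> collects the labels whose successor has their own parity instead of the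
  opposite one. The swap creates such defects exactly at \<open>x\<close> and \<open>y\<close>,
  which differ in parity and exchange successors. Deleting a defective label repairs the face, as
  the label and its successor have the same parity.\<close>

definition alternates :: "(nat \<Rightarrow> nat) \<Rightarrow> nat set \<Rightarrow> nat set \<Rightarrow> bool" where
  "alternates \<sigma> S F \<longleftrightarrow> (\<forall>z\<in>S. even (\<sigma> z) \<longleftrightarrow> (even z \<longleftrightarrow> z \<in> F))"

text \<open>Parity alternates along the list, so rotating by at most one place yields a normal form
  in which position determines parity.\<close>

lemma traverses_odd_start:
  assumes "traverses \<sigma> xs" "alternates \<sigma> (set xs) {}"
  shows "\<exists>ys. traverses \<sigma> ys \<and> set ys = set xs \<and> length ys = length xs \<and>
    (\<forall>k<length ys. odd (ys ! k) \<longleftrightarrow> even k)"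
proof -
  have parity: "\<forall>k<length ys. odd (ys ! k) \<longleftrightarrow> even k"
    if ys: "traverses \<sigma> ys" "set ys = set xs" and hd: "ys \<noteq> [] \<Longrightarrow> odd (hd ys)" for ys
  proof (intro allI impI)
    fix k assume "k < length ys"
    then show "odd (ys ! k) \<longleftrightarrow> even k"
    proof (induction k)
      case 0
      then have "ys \<noteq> []" by auto
      then show ?case using hd by (simp add: hd_conv_nth)
    next
      case (Suc k)
      then have k: "k < length ys" by simp
      have "\<sigma> (ys ! k) = rotate1 ys ! k"
        using ys(1) nth_map[OF k, of \<sigma>] by (simp add: traverses_def)
      also have "\<dots> = ys ! Suc k"
        using nth_rotate1[OF k] Suc.prems by simp
      finally show ?case
        using Suc.IH[OF k] assms(2) nth_mem[OF k] ys(2) by (auto simp: alternates_def)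
    qed
  qed
  show ?thesis
  proof (cases "xs = [] \<or> odd (hd xs)")
    case True
    then show ?thesis using parity[OF assms(1)] assms(1) by (intro exI[of _ xs]) auto
  next
    case False
    then obtain x zs where xs: "xs = x # zs" "even x" by (cases xs) auto
    have tr: "traverses \<sigma> (zs @ [x])"
      using traverses_append_commute[of \<sigma> "[x]" zs] assms(1) by (simp add: xs)
    have "hd (zs @ [x]) = \<sigma> x"
      using assms(1) by (cases zs) (auto simp: traverses_def xs)
    then have "odd (hd (zs @ [x]))" using assms(2) xs by (simp add: alternates_def)
    then show ?thesis
      using parity[OF tr] tr by (intro exI[of _ "zs @ [x]"]) (simp add: xs)
  qed
qed

lemma ex_map_eq:
  assumes "distinct xs" "length xs = length ys"
  shows "\<exists>f. map f xs = ys"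
  by (rule exI[of _ "the \<circ> map_of (zip xs ys)"], rule nth_equalityI)
    (use assms in \<open>simp_all add: map_of_zip_nth\<close>)

text \<open>The count depends on the face lengths only: matching the odd-started lists position by
  position is a relabelling that respects both the faces and parity.\<close>

lemma card_planar_pairings_lists:
  assumes \<sigma>: "permutation \<sigma>" "traverses \<sigma> xs" "traverses \<sigma> ys" "set xs \<inter> set ys = {}"
      "alternates \<sigma> (set xs \<union> set ys) {}"
    and \<sigma>': "permutation \<sigma>'" "traverses \<sigma>' xs'" "traverses \<sigma>' ys'" "set xs' \<inter> set ys' = {}"
      "alternates \<sigma>' (set xs' \<union> set ys') {}"
    and len: "length xs = length xs'" "length ys = length ys'"
  shows "card (planar_pairings (set xs \<union> set ys) \<sigma> {}) =
    card (planar_pairings (set xs' \<union> set ys') \<sigma>' {})"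
proof -
  have alt: "alternates \<sigma> (set xs) {}" "alternates \<sigma> (set ys) {}"
    "alternates \<sigma>' (set xs') {}" "alternates \<sigma>' (set ys') {}"
    using \<sigma>(5) \<sigma>'(5) by (auto simp: alternates_def)
  obtain us where us: "traverses \<sigma> us" "set us = set xs" "length us = length xs"
    "\<forall>k<length us. odd (us ! k) \<longleftrightarrow> even k" using traverses_odd_start[OF \<sigma>(2) alt(1)] by blast
  obtain vs where vs: "traverses \<sigma> vs" "set vs = set ys" "length vs = length ys"
    "\<forall>k<length vs. odd (vs ! k) \<longleftrightarrow> even k" using traverses_odd_start[OF \<sigma>(3) alt(2)] by blast
  obtain us' where us': "traverses \<sigma>' us'" "set us' = set xs'" "length us' = length xs'"
    "\<forall>k<length us'. odd (us' ! k) \<longleftrightarrow> even k" using traverses_odd_start[OF \<sigma>'(2) alt(3)] by blast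
  obtain vs' where vs': "traverses \<sigma>' vs'" "set vs' = set ys'" "length vs' = length ys'"
    "\<forall>k<length vs'. odd (vs' ! k) \<longleftrightarrow> even k" using traverses_odd_start[OF \<sigma>'(3) alt(4)] by blast
  have dist: "distinct (us @ vs)" "distinct (us' @ vs')"
    using us(1,2) vs(1,2) us'(1,2) vs'(1,2) \<sigma>(4) \<sigma>'(4) by (auto simp: traverses_def)
  obtain f where f: "map f (us @ vs) = us' @ vs'"
    using ex_map_eq[OF dist(1), of "us' @ vs'"] us(3) us'(3) vs(3) vs'(3) len by auto
  then have fs: "map f us = us'" "map f vs = vs'"
    using us(3) us'(3) len by (simp_all add: append_eq_append_conv)
  have eq: "\<sigma>' (f z) = f (\<sigma> z)" if "traverses \<sigma> ws" "traverses \<sigma>' (map f ws)" "z \<in> set ws" for ws z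
  proof -
    have "map (\<lambda>z. \<sigma>' (f z)) ws = map (\<lambda>z. f (\<sigma> z)) ws"
      using that(1,2) by (simp add: traverses_def rotate1_map flip: map_map[unfolded comp_def])
    then show ?thesis using that(3) by simp
  qed
  have par: "even (f z) \<longleftrightarrow> even z"
    if "\<forall>k<length ws. odd (ws ! k) \<longleftrightarrow> even k" "\<forall>k<length ws. odd (map f ws ! k) \<longleftrightarrow> even k"
      "z \<in> set ws" for ws z
    using that by (auto simp: in_set_conv_nth)
  have S: "set xs \<union> set ys = set (us @ vs)" using us(2) vs(2) by simp
  have "set xs' \<union> set ys' = f ` set (us @ vs)"
    using us'(2) vs'(2) unfolding fs[symmetric] by (simp add: image_Un)
  moreover have "card (planar_pairings (f ` set (us @ vs)) \<sigma>' (f ` {})) =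
      card (planar_pairings (set (us @ vs)) \<sigma> {})"
  proof (rule card_planar_pairings_image)
    show "\<sigma> ` set (us @ vs) \<subseteq> set (us @ vs)"
      using traverses_image[OF us(1)] traverses_image[OF vs(1)] by auto
    show "inj_on f (set (us @ vs))"
      using dist(2) f by (metis distinct_map)
    show "\<sigma>' (f z) = f (\<sigma> z)" if "z \<in> set (us @ vs)" for z
      using that eq[OF us(1), of z] eq[OF vs(1), of z] us'(1) vs'(1) fs by auto
    show "even (f z) \<longleftrightarrow> even z" if "z \<in> set (us @ vs)" for z
      using that par[OF us(4), of z] par[OF vs(4), of z] us'(3,4) vs'(3,4) us(3) vs(3) len fs by auto
  qed (use \<sigma> \<sigma>' in simp_all)
  ultimately show ?thesis by (simp add: S)
qed

text \<open>\<open>disc 0 = 1\<close> counts the sphere with one vertex and no edge, \<open>annulus 0 b = 0\<close>.\<close>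

definition disc :: "nat \<Rightarrow> nat" where
  "disc n = (if n = 0 then 1 else card (planar_pairings {1..2 * n} (face_perm [2 * n]) {}))"

definition annulus :: "nat \<Rightarrow> nat \<Rightarrow> nat" where
  "annulus a b = (if a = 0 \<or> b = 0 then 0
    else card (planar_pairings {1..2 * (a + b)} (face_perm [2 * a, 2 * b]) {}))"

lemma traverses_cycle_of_list: "distinct xs \<Longrightarrow> traverses (cycle_of_list xs) xs"
  using cyclic_rotation[of xs 1] by (simp add: traverses_def)

text \<open>Inside the interval the cycle adds 1. The wrap-around changes parity because
  \<open>k\<close> is even.\<close>

lemma alternates_cycle_of_list_upt:
  assumes "odd l" "even k"
  shows "alternates (cycle_of_list [l..<l + k]) {l..<l + k} {}"
  unfolding alternates_def
proof
  fix z assume "z \<in> {l..<l + k}"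
  then obtain i where i: "z = l + i" "i < k" by (metis atLeastLessThan_iff le_Suc_ex add_less_cancel_left)
  let ?xs = "[l..<l + k]"
  have "cycle_of_list ?xs (?xs ! i) = map (cycle_of_list ?xs) ?xs ! i"
    using i by simp
  also have "\<dots> = rotate1 ?xs ! i"
    using traverses_cycle_of_list[of ?xs] by (simp add: traverses_def)
  also have "\<dots> = l + Suc i mod k"
    using i by (simp add: nth_rotate1)
  finally have "cycle_of_list ?xs z = l + Suc i mod k" using i by simp
  moreover have "even (Suc i mod k) \<longleftrightarrow> odd i"
    using assms(2) by (simp add: dvd_mod_iff)
  ultimately show "even (cycle_of_list ?xs z) \<longleftrightarrow> (even z \<longleftrightarrow> z \<in> {})"
    using assms(1) i by auto
qed

section \<open>Standard faces and their counts\<close>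

lemma face_perm_single:
  fixes n :: nat
  defines "\<sigma> \<equiv> face_perm [2 * n]" and "xs \<equiv> [1..<1 + 2 * n]"
  shows "permutation \<sigma>" "traverses \<sigma> xs" "alternates \<sigma> (set xs) {}" "set xs = {1..2 * n}"
proof -
  have \<sigma>: "\<sigma> = cycle_of_list xs"
    by (simp add: \<sigma>_def xs_def face_perm_def polygon_def offset_def)
  show "permutation \<sigma>" unfolding \<sigma> by (rule permutation_of_cycle)
  show "traverses \<sigma> xs" unfolding \<sigma> xs_def by (rule traverses_cycle_of_list[OF distinct_upt])
  show "alternates \<sigma> (set xs) {}"
    unfolding \<sigma> xs_def set_upt by (rule alternates_cycle_of_list_upt) simp_all
  show "set xs = {1..2 * n}" by (auto simp: xs_def)
qed

lemma face_perm_double: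
  fixes a b :: nat
  defines "\<sigma> \<equiv> face_perm [2 * a, 2 * b]"
    and "xs \<equiv> [1..<1 + 2 * a]" and "ys \<equiv> [1 + 2 * a..<1 + 2 * a + 2 * b]"
  shows "permutation \<sigma>" "traverses \<sigma> xs" "traverses \<sigma> ys" "alternates \<sigma> (set xs \<union> set ys) {}"
    "set xs \<union> set ys = {1..2 * (a + b)}" "set xs \<inter> set ys = {}"
proof -
  have \<sigma>: "\<sigma> = cycle_of_list xs \<circ> cycle_of_list ys"
    by (simp add: \<sigma>_def xs_def ys_def face_perm_def polygon_def offset_def numeral_2_eq_2)
  show "permutation \<sigma>" unfolding \<sigma> by (intro permutation_compose permutation_of_cycle)
  show disj: "set xs \<inter> set ys = {}" by (auto simp: xs_def ys_def)
  have trx: "traverses (cycle_of_list xs) xs" and tr_y: "traverses (cycle_of_list ys) ys"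
    unfolding xs_def ys_def by (rule traverses_cycle_of_list[OF distinct_upt])+
  have x: "\<sigma> z = cycle_of_list xs z" if "z \<in> set xs" for z
  proof -
    have "z \<notin> set ys" using that disj by blast
    then show ?thesis using id_outside_supp[of z ys] by (simp add: \<sigma>)
  qed
  have y: "\<sigma> z = cycle_of_list ys z" if "z \<in> set ys" for z
  proof -
    have "cycle_of_list ys z \<in> set ys" using traverses_image[OF tr_y] that by blast
    then have "cycle_of_list ys z \<notin> set xs" using disj by blast
    then show ?thesis using id_outside_supp[of "cycle_of_list ys z" xs] by (simp add: \<sigma>)
  qed
  show "traverses \<sigma> xs" by (rule traverses_cong[OF trx x])
  show "traverses \<sigma> ys" by (rule traverses_cong[OF tr_y y])
  have "alternates (cycle_of_list xs) (set xs) {}" "alternates (cycle_of_list ys) (set ys) {}"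
    unfolding xs_def ys_def set_upt by (rule alternates_cycle_of_list_upt; simp)+
  then show "alternates \<sigma> (set xs \<union> set ys) {}"
    unfolding alternates_def ball_Un by (metis x y)
  show "set xs \<union> set ys = {1..2 * (a + b)}" by (auto simp: xs_def ys_def)
qed

lemma card_planar_pairings_disc:
  assumes "permutation \<sigma>" "traverses \<sigma> xs" "alternates \<sigma> (set xs) {}" "length xs = 2 * n" "0 < n"
  shows "card (planar_pairings (set xs) \<sigma> {}) = disc n"
proof -
  \<comment> \<open>The empty list takes the place of the second face, so the relabelling lemma for
    two faces applies.\<close>
  have nil: "traverses p []" for p by (simp add: traverses_def)
  have "card (planar_pairings (set xs \<union> set []) \<sigma> {}) =
      card (planar_pairings (set [1..<1 + 2 * n] \<union> set []) (face_perm [2 * n]) {})"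
    by (rule card_planar_pairings_lists) (use assms nil face_perm_single[of n] in auto)
  then show ?thesis using assms(5) face_perm_single(4)[of n] by (simp add: disc_def)
qed

lemma card_planar_pairings_annulus:
  assumes "permutation \<sigma>" "traverses \<sigma> xs" "traverses \<sigma> ys" "set xs \<inter> set ys = {}"
    "alternates \<sigma> (set xs \<union> set ys) {}" "length xs = 2 * a" "length ys = 2 * b" "0 < a" "0 < b"
  shows "card (planar_pairings (set xs \<union> set ys) \<sigma> {}) = annulus a b"
proof -
  have "card (planar_pairings (set xs \<union> set ys) \<sigma> {}) =
      card (planar_pairings (set [1..<1 + 2 * a] \<union> set [1 + 2 * a..<1 + 2 * a + 2 * b])
        (face_perm [2 * a, 2 * b]) {})"
    by (rule card_planar_pairings_lists) (use assms face_perm_double[of a b] in auto)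
  then show ?thesis using assms(8,9) face_perm_double(5)[of a b] by (simp add: annulus_def)
qed

subsection \<open>Rooted discs and annuli\<close>

text \<open>The shortened permutation is hidden behind an existential so that removals can be
  chained. The agreement outside \<open>x # xs\<close> is what keeps the other face intact.\<close>

lemma traverses_remove:
  assumes S: "finite S" and \<sigma>: "permutation \<sigma>" "\<sigma> ` S \<subseteq> S" "alternates \<sigma> S F"
    and xs: "traverses \<sigma> (x # xs)" "xs \<noteq> []" "set (x # xs) \<subseteq> S" and F: "x \<in> F"
  shows "\<exists>\<sigma>' xs'. permutation \<sigma>' \<and> \<sigma>' ` (S - {x}) \<subseteq> S - {x} \<and> alternates \<sigma>' (S - {x}) (F - {x}) \<and>
    traverses \<sigma>' xs' \<and> set xs' = set xs \<and> length xs' = length xs \<and>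
    (\<forall>z. z \<notin> set (x # xs) \<longrightarrow> \<sigma>' z = \<sigma> z) \<and>
    planar_pairings S \<sigma> F = planar_pairings (S - {x}) \<sigma>' (F - {x})"
proof -
  \<comment> \<open>In cyclic order the last entry precedes \<open>x\<close>, so this is the label
    to be linked to the successor of \<open>x\<close>.\<close>
  define w where "w = last xs"
  define zs where "zs = butlast xs"
  have xs_eq: "xs = zs @ [w]" using xs(2) by (simp add: w_def zs_def)
  have "traverses \<sigma> ([w] @ (x # zs))"
    by (rule traverses_append_commute) (use xs(1) in \<open>simp add: xs_eq\<close>)
  then have tr: "traverses \<sigma> (w # [] @ x # zs)" by simp
  then have w: "\<sigma> w = x" "w \<noteq> x" by (auto simp: traverses_def)
  have wx: "w \<in> S" "x \<in> S" using xs(3) by (auto simp: xs_eq)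
  let ?\<sigma> = "\<sigma> \<circ> transpose w x"
  have p: "permutation ?\<sigma>" by (rule permutation_compose[OF \<sigma>(1) permutation_swap_id])
  have "?\<sigma> ` S \<subseteq> S"
    by (rule comp_image_subset[OF \<sigma>(2) transpose_image_subset]) (use wx in simp)
  then have im: "?\<sigma> ` (S - {x}) \<subseteq> S - {x}"
    by (rule permutation_image_Diff[OF p S]) (use wx w in simp_all)
  have alt: "alternates ?\<sigma> (S - {x}) (F - {x})"
    unfolding alternates_def
  proof
    fix z assume z: "z \<in> S - {x}"
    show "even (?\<sigma> z) \<longleftrightarrow> (even z \<longleftrightarrow> z \<in> F - {x})"
    proof (cases "z = w")
      case True
      then show ?thesis
        using \<sigma>(3) F wx w unfolding alternates_def by auto
    next
      case False
      then show ?thesis using \<sigma>(3) z unfolding alternates_def by simp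
    qed
  qed
  have off: "?\<sigma> z = \<sigma> z" if "z \<notin> set (x # xs)" for z
    using that by (simp add: xs_eq)
  have "set (w # zs) = set xs" "length (w # zs) = length xs" by (simp_all add: xs_eq)
  then show ?thesis
    using p im alt traverses_split(1)[OF tr] off planar_pairings_remove[OF S \<sigma>(1,2) wx(1) w F]
    by (intro exI[of _ ?\<sigma>] exI[of _ "w # zs"] conjI allI impI)
qed

text \<open>One face, one unpaired label and one vertex: the equation reads
  \<open>1 + 1 + 1 = 1 + 2\<close>. Deleting this label would leave the sphere without edges, whence
  \<open>disc 0 = 1\<close>.\<close>

lemma planar_pairings_singleton:
  assumes "\<sigma> x = x"
  shows "planar_pairings {x} \<sigma> {x} = {id}"
proof -
  have "pairings {x} {x} = {id}"
    by (auto simp: pairings_def fun_eq_iff permutes_def)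
  moreover have "planar_on {x} \<sigma> id"
  proof -
    have "transitive_on {\<sigma>, id} {x}" by (auto simp: transitive_on_def)
    moreover have "num_cycles p {x} = 1" if "p x = x" for p
      using num_cycles_fixed[of "{x}" p] that by simp
    ultimately show ?thesis using assms by (simp add: planar_on_def)
  qed
  ultimately show ?thesis by (auto simp: planar_pairings_def)
qed

lemma card_planar_pairings_rooted_disc:
  assumes \<sigma>: "permutation \<sigma>" "traverses \<sigma> (x # xs)" "alternates \<sigma> (set (x # xs)) {x}"
    and len: "length xs = 2 * n"
  shows "card (planar_pairings (set (x # xs)) \<sigma> {x}) = disc n"
proof (cases "xs = []")
  case True
  then show ?thesis
    using \<sigma>(2) len planar_pairings_singleton[of \<sigma> x] by (simp add: traverses_def disc_def)
next
  case False
  have im: "\<sigma> ` set (x # xs) \<subseteq> set (x # xs)"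
    using traverses_image[OF \<sigma>(2)] by simp
  obtain \<sigma>' xs' where *: "permutation \<sigma>'" "alternates \<sigma>' (set (x # xs) - {x}) ({x} - {x})"
    "traverses \<sigma>' xs'" "set xs' = set xs" "length xs' = length xs"
    "planar_pairings (set (x # xs)) \<sigma> {x} = planar_pairings (set (x # xs) - {x}) \<sigma>' ({x} - {x})"
    using traverses_remove[OF finite_set \<sigma>(1) im \<sigma>(3,2) False order_refl singletonI] by blast
  have S: "set (x # xs) - {x} = set xs'" using \<sigma>(2) *(4) by (auto simp: traverses_def)
  have "0 < n" using False len by (cases n) simp_all
  moreover have "alternates \<sigma>' (set xs') {}" using *(2) by (simp only: S Diff_cancel)
  moreover have "length xs' = 2 * n" using *(5) len by simp
  ultimately have "card (planar_pairings (set xs') \<sigma>' {}) = disc n"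
    by (intro card_planar_pairings_disc[OF *(1,3)])
  then show ?thesis by (simp only: *(6) S Diff_cancel)
qed

text \<open>The unpaired label is deleted from its face. If it is alone there, it forms a component
  by itself and cannot be connected to \<open>ys\<close>, in accordance with
  \<open>annulus 0 b = 0\<close>.\<close>

lemma card_planar_pairings_rooted_annulus:
  assumes \<sigma>: "permutation \<sigma>" "traverses \<sigma> (x # xs)" "traverses \<sigma> ys"
    "alternates \<sigma> (set (x # xs) \<union> set ys) {x}" "set (x # xs) \<inter> set ys = {}"
    and len: "length xs = 2 * a" "length ys = 2 * b" "0 < b"
  shows "card (planar_pairings (set (x # xs) \<union> set ys) \<sigma> {x}) = annulus a b"
proof (cases "xs = []")
  case True
  have "\<not> planar_on (set (x # xs) \<union> set ys) \<sigma> \<iota>" if "\<iota> \<in> pairings (set (x # xs) \<union> set ys) {x}" for \<iota>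
  proof
    assume "planar_on (set (x # xs) \<union> set ys) \<sigma> \<iota>"
    then have "transitive_on {\<sigma>, \<iota>} (set (x # xs) \<union> set ys)" by (simp add: planar_on_def)
    then have "{x} = set (x # xs) \<union> set ys"
      by (rule transitive_on_pairD)
        (use that \<sigma>(2) True in \<open>auto simp: traverses_def pairings_def\<close>)
    then show False using len(2,3) \<sigma>(5) by (cases ys) auto
  qed
  then have "planar_pairings (set (x # xs) \<union> set ys) \<sigma> {x} = {}"
    unfolding planar_pairings_def by blast
  then show ?thesis using True len(1) by (simp add: annulus_def)
next
  case False
  let ?S = "set (x # xs) \<union> set ys"
  have im: "\<sigma> ` ?S \<subseteq> ?S"
    using traverses_image[OF \<sigma>(2)] traverses_image[OF \<sigma>(3)] by (simp only: image_Un)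
  have fin: "finite ?S" by simp
  obtain \<sigma>' xs' where *: "permutation \<sigma>'" "alternates \<sigma>' (?S - {x}) ({x} - {x})"
    "traverses \<sigma>' xs'" "set xs' = set xs" "length xs' = length xs"
    "\<forall>z. z \<notin> set (x # xs) \<longrightarrow> \<sigma>' z = \<sigma> z"
    "planar_pairings ?S \<sigma> {x} = planar_pairings (?S - {x}) \<sigma>' ({x} - {x})"
    using traverses_remove[OF fin \<sigma>(1) im \<sigma>(4,2) False Un_upper1 singletonI] by blast
  have S: "?S - {x} = set xs' \<union> set ys"
    using \<sigma>(2,5) *(4) by (auto simp: traverses_def)
  have "\<sigma>' z = \<sigma> z" if "z \<in> set ys" for z
    using *(6) that \<sigma>(5) by blast
  then have ys: "traverses \<sigma>' ys" by (rule traverses_cong[OF \<sigma>(3)])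
  have "set xs' \<inter> set ys = {}" using *(4) \<sigma>(5) by auto
  moreover have "0 < a" using False len(1) by (cases a) simp_all
  moreover have "alternates \<sigma>' (set xs' \<union> set ys) {}" using *(2) by (simp only: S Diff_cancel)
  moreover have "length xs' = 2 * a" using *(5) len(1) by simp
  ultimately have "card (planar_pairings (set xs' \<union> set ys) \<sigma>' {}) = annulus a b"
    using len(2,3) by (intro card_planar_pairings_annulus[OF *(1,3) ys])
  then show ?thesis by (simp only: *(7) S Diff_cancel)
qed

section \<open>The partner on another face and on the same face\<close>

lemma alternates_glue:
  assumes "alternates \<tau> S {}" "x \<in> S" "y \<in> S" "odd x" "even y" "T \<subseteq> S"
  shows "alternates (\<tau> \<circ> transpose x y) T (T \<inter> {x, y})"
  unfolding alternates_def
proof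
  fix z assume "z \<in> T"
  then have z: "z \<in> S" using assms(6) by blast
  consider "z = x" | "z = y" | "z \<noteq> x" "z \<noteq> y" by blast
  then show "even ((\<tau> \<circ> transpose x y) z) \<longleftrightarrow> (even z \<longleftrightarrow> z \<in> T \<inter> {x, y})"
    by cases (use assms z \<open>z \<in> T\<close> in \<open>auto simp: alternates_def\<close>)
qed

text \<open>The merged face runs through both \<open>x\<close> and \<open>y\<close>, now unpaired.
  Deleting them one after the other leaves a single face with \<open>2 * n\<close> labels.\<close>

lemma card_glue_distinct_faces:
  assumes \<tau>: "permutation \<tau>" "traverses \<tau> (x # us)" "traverses \<tau> (y # vs)"
    "set (x # us) \<inter> set (y # vs) = {}" "alternates \<tau> (set (x # us) \<union> set (y # vs)) {}"
    and xy: "odd x" "even y" and ne: "us \<noteq> []" "vs \<noteq> []" and len: "length us + length vs = 2 * n"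
  shows "card {\<iota> \<in> planar_pairings (set (x # us) \<union> set (y # vs)) \<tau> {}. \<iota> x = y} = disc n"
proof -
  let ?S = "set (x # us) \<union> set (y # vs)" and ?\<sigma> = "\<tau> \<circ> transpose x y"
  have S: "finite ?S" "x \<in> ?S" "y \<in> ?S" by simp_all
  have im: "\<tau> ` ?S \<subseteq> ?S"
    using traverses_image[OF \<tau>(2)] traverses_image[OF \<tau>(3)] by (simp only: image_Un)
  have "y \<notin> orbit \<tau> x" using traverses_orbit[OF \<tau>(2), of x] \<tau>(4) by auto
  then have 1: "card {\<iota> \<in> planar_pairings ?S \<tau> {}. \<iota> x = y} = card (planar_pairings ?S ?\<sigma> {x, y})"
    by (rule card_planar_pairings_merge[OF S xy \<tau>(1) im])
  have \<sigma>: "permutation ?\<sigma>" by (rule permutation_compose[OF \<tau>(1) permutation_swap_id])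
  have \<sigma>im: "?\<sigma> ` ?S \<subseteq> ?S"
    by (rule comp_image_subset[OF im transpose_image_subset]) simp
  have alt: "alternates ?\<sigma> ?S {x, y}"
    using alternates_glue[OF \<tau>(5) S(2,3) xy order_refl] by (simp add: insert_commute Int_insert_right)
  have tr: "traverses ?\<sigma> (x # vs @ y # us)" by (rule traverses_merge[OF \<tau>(2-4)])
  have d: "distinct (x # vs @ y # us)" using tr by (simp add: traverses_def)
  have sub: "vs @ y # us \<noteq> []" "set (x # vs @ y # us) \<subseteq> ?S" by auto
  obtain \<sigma>1 xs where s1: "permutation \<sigma>1" "\<sigma>1 ` (?S - {x}) \<subseteq> ?S - {x}"
      "alternates \<sigma>1 (?S - {x}) ({x, y} - {x})" "traverses \<sigma>1 xs" "set xs = set (vs @ y # us)"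
      "length xs = length (vs @ y # us)"
      "planar_pairings ?S ?\<sigma> {x, y} = planar_pairings (?S - {x}) \<sigma>1 ({x, y} - {x})"
    using traverses_remove[OF S(1) \<sigma> \<sigma>im alt tr _ _ insertI1] sub by blast
  \<comment> \<open>The removal lemma does not tell where the new list starts, so \<open>y\<close>
    is located in it and rotated to the front.\<close>
  obtain as bs where ab: "xs = as @ y # bs" using split_list[of y xs] s1(5) by auto
  have tr1: "traverses \<sigma>1 (y # bs @ as)"
    using traverses_append_commute[of \<sigma>1 as "y # bs"] s1(4) by (simp add: ab)
  have set1: "set (y # bs @ as) = ?S - {x}" using s1(5) d by (auto simp: ab)
  have F1: "{x, y} - {x} = {y}" using d by auto
  have ne1: "bs @ as \<noteq> []" using s1(6) ne by (auto simp: ab)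
  obtain \<sigma>2 xs2 where s2: "permutation \<sigma>2"
      "alternates \<sigma>2 (?S - {x} - {y}) ({y} - {y})" "traverses \<sigma>2 xs2" "set xs2 = set (bs @ as)"
      "length xs2 = length (bs @ as)"
      "planar_pairings (?S - {x}) \<sigma>1 {y} = planar_pairings (?S - {x} - {y}) \<sigma>2 ({y} - {y})"
    using traverses_remove[OF _ s1(1,2) s1(3)[unfolded F1] tr1 ne1 eq_refl[OF set1] singletonI]
      finite_Diff[OF S(1)] by blast
  have set2: "?S - {x} - {y} = set xs2"
    using set1 s2(4) tr1 by (auto simp: traverses_def)
  have len2: "length xs2 = 2 * n" using s2(5) s1(6) len by (simp add: ab)
  have "0 < n" using len ne by (cases us) auto
  moreover have "alternates \<sigma>2 (set xs2) {}" using s2(2) by (simp only: set2 Diff_cancel)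
  ultimately have "card (planar_pairings (set xs2) \<sigma>2 {}) = disc n"
    using card_planar_pairings_disc[OF s2(1,3) _ len2] by blast
  then show ?thesis by (simp only: 1 s1(7) s2(6) F1 set2 Diff_cancel)
qed

text \<open>The split leaves three faces: \<open>?X\<close> through \<open>x\<close>,
  \<open>?Y\<close> through \<open>y\<close>, and the untouched \<open>?W\<close>. The sphere of
  \<open>x\<close> carries \<open>?X\<close> alone or together with \<open>?W\<close>; these are the
  two summands.\<close>

lemma card_glue_same_face:
  assumes \<tau>: "permutation \<tau>" "traverses \<tau> (x # us @ y # vs)" "traverses \<tau> ws"
    "set (x # us @ y # vs) \<inter> set ws = {}" "alternates \<tau> (set (x # us @ y # vs) \<union> set ws) {}"
    and xy: "odd x" "even y"
    and len: "length us = 2 * a" "length vs = 2 * b" "length ws = 2 * c" "0 < c"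
  shows "card {\<iota> \<in> planar_pairings (set (x # us @ y # vs) \<union> set ws) \<tau> {}. \<iota> x = y} =
    disc b * annulus a c + annulus b c * disc a"
proof -
  let ?S = "set (x # us @ y # vs) \<union> set ws" and ?\<sigma> = "\<tau> \<circ> transpose x y"
  let ?X = "set (x # vs)" and ?Y = "set (y # us)" and ?W = "set ws"
  have S: "finite ?S" "x \<in> ?S" "y \<in> ?S" by simp_all
  have im: "\<tau> ` ?S \<subseteq> ?S"
    using traverses_image[OF \<tau>(2)] traverses_image[OF \<tau>(3)] by (simp only: image_Un)
  have d: "distinct (x # us @ y # vs)" using \<tau>(2) by (simp add: traverses_def)
  have part: "?S = ?X \<union> ?Y \<union> ?W" by auto
  have disj: "?X \<inter> ?Y = {}" "?X \<inter> ?W = {}" "?Y \<inter> ?W = {}" using d \<tau>(4) by auto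
  have W: "?W \<noteq> {}" using len(3,4) by auto
  have \<sigma>: "permutation ?\<sigma>" by (rule permutation_compose[OF \<tau>(1) permutation_swap_id])
  have trX: "traverses ?\<sigma> (x # vs)" and trY: "traverses ?\<sigma> (y # us)"
    using traverses_split[OF \<tau>(2)] by blast+
  have trW: "traverses ?\<sigma> ws"
  proof (rule traverses_cong[OF \<tau>(3)])
    fix z assume "z \<in> ?W"
    then have "z \<noteq> x" "z \<noteq> y" using \<tau>(4) by auto
    then show "?\<sigma> z = \<tau> z" by simp
  qed
  have alt: "alternates ?\<sigma> T (T \<inter> {x, y})" if "T \<subseteq> ?S" for T
    by (rule alternates_glue[OF \<tau>(5) S(2,3) xy that])
  have "{T. T \<subseteq> ?S \<and> ?\<sigma> ` T \<subseteq> T \<and> x \<in> T \<and> y \<notin> T} = {?X, ?X \<union> ?W}"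
  proof (intro equalityI subsetI)
    fix T assume "T \<in> {T. T \<subseteq> ?S \<and> ?\<sigma> ` T \<subseteq> T \<and> x \<in> T \<and> y \<notin> T}"
    then have T: "T \<subseteq> ?S" "?\<sigma> ` T \<subseteq> T" "x \<in> T" "y \<notin> T" by simp_all
    \<comment> \<open>A closed set that meets a face contains it, so \<open>T\<close> is a union of
      faces.\<close>
    have face: "set zs \<subseteq> T" if "traverses ?\<sigma> zs" "z \<in> set zs" "z \<in> T" for zs z
      using orbit_subset_invariant[OF T(2) that(3)] traverses_orbit[OF that(1,2)] by simp
    have "?X \<subseteq> T" using face[OF trX _ T(3)] by simp
    moreover have "?Y \<inter> T = {}" using face[OF trY] T(4) by auto
    moreover have "?W \<subseteq> T \<or> ?W \<inter> T = {}" using face[OF trW] by blast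
    ultimately have "T = ?X \<or> T = ?X \<union> ?W"
      using T(1) unfolding part by blast
    then show "T \<in> {?X, ?X \<union> ?W}" by blast
  next
    fix T assume "T \<in> {?X, ?X \<union> ?W}"
    moreover have "?\<sigma> ` ?X \<subseteq> ?X" "?\<sigma> ` (?X \<union> ?W) \<subseteq> ?X \<union> ?W"
      using traverses_image[OF trX] traverses_image[OF trW] by (simp_all only: image_Un order_refl)
    moreover have "?X \<subseteq> ?S" "?X \<union> ?W \<subseteq> ?S" "x \<in> ?X" "y \<notin> ?X" "y \<notin> ?W"
      using disj by auto
    ultimately show "T \<in> {T. T \<subseteq> ?S \<and> ?\<sigma> ` T \<subseteq> T \<and> x \<in> T \<and> y \<notin> T}" by blast
  qed
  moreover have "?X \<noteq> ?X \<union> ?W" using W disj(2) by (metis Int_absorb1 Un_upper2)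
  moreover have "?S - ?X = ?Y \<union> ?W" "?S - (?X \<union> ?W) = ?Y"
  proof -
    have "(P \<union> Q \<union> R) - P = Q \<union> R" "(P \<union> Q \<union> R) - (P \<union> R) = Q"
      if "P \<inter> Q = {}" "P \<inter> R = {}" "Q \<inter> R = {}" for P Q R :: "nat set"
      using that by blast+
    from this[OF disj] show "?S - ?X = ?Y \<union> ?W" "?S - (?X \<union> ?W) = ?Y" unfolding part .
  qed
  moreover have "y \<in> orbit \<tau> x" using traverses_orbit[OF \<tau>(2), of x] by simp
  ultimately have 1: "card {\<iota> \<in> planar_pairings ?S \<tau> {}. \<iota> x = y} =
      card (planar_pairings ?X ?\<sigma> {x}) * card (planar_pairings (?Y \<union> ?W) ?\<sigma> {y}) +
      card (planar_pairings (?X \<union> ?W) ?\<sigma> {x}) * card (planar_pairings ?Y ?\<sigma> {y})"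
    using card_planar_pairings_split[OF S xy \<tau>(1) im] by simp
  have F: "?X \<inter> {x, y} = {x}" "(?X \<union> ?W) \<inter> {x, y} = {x}" "?Y \<inter> {x, y} = {y}"
    "(?Y \<union> ?W) \<inter> {x, y} = {y}" using disj by auto
  have sub: "?X \<subseteq> ?S" "?X \<union> ?W \<subseteq> ?S" "?Y \<subseteq> ?S" "?Y \<union> ?W \<subseteq> ?S" unfolding part by blast+
  have "card (planar_pairings ?X ?\<sigma> {x}) = disc b"
    by (rule card_planar_pairings_rooted_disc[OF \<sigma> trX alt[OF sub(1), unfolded F] len(2)])
  moreover have "card (planar_pairings ?Y ?\<sigma> {y}) = disc a"
    by (rule card_planar_pairings_rooted_disc[OF \<sigma> trY alt[OF sub(3), unfolded F] len(1)])
  moreover have "card (planar_pairings (?X \<union> ?W) ?\<sigma> {x}) = annulus b c"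
    by (rule card_planar_pairings_rooted_annulus[OF \<sigma> trX trW alt[OF sub(2), unfolded F] disj(2) len(2,3,4)])
  moreover have "card (planar_pairings (?Y \<union> ?W) ?\<sigma> {y}) = annulus a c"
    by (rule card_planar_pairings_rooted_annulus[OF \<sigma> trY trW alt[OF sub(4), unfolded F] disj(3) len(1,3,4)])
  ultimately show ?thesis using 1 by simp
qed

subsection \<open>The recursion\<close>

lemma annulus_rec:
  assumes "0 < a" "0 < b"
  shows "annulus a b = 2 * (\<Sum>i<a. disc i * annulus (a - 1 - i) b) + b * disc (a + b - 1)"
proof -
  define \<tau> where "\<tau> = face_perm [2 * a, 2 * b]"
  define xs where "xs = [1..<1 + 2 * a]"
  define ys where "ys = [1 + 2 * a..<1 + 2 * a + 2 * b]"
  define S where "S = {1..2 * (a + b)}"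
  note fp = face_perm_double[of a b, folded \<tau>_def xs_def ys_def S_def]
  \<comment> \<open>By the coloring the partner of \<open>1\<close> is even. The values
    \<open>j \<le> a\<close> place it on the first face, the other \<open>b\<close> values on the
    second.\<close>
  define G where "G = (\<lambda>j. {\<iota> \<in> planar_pairings S \<tau> {}. \<iota> 1 = 2 * j})"
  have "planar_pairings S \<tau> {} = (\<Union>j\<in>{1..a + b}. G j)"
  proof (intro equalityI subsetI)
    fix \<iota> assume \<iota>: "\<iota> \<in> planar_pairings S \<tau> {}"
    then have "\<iota> permutes S" "\<forall>z\<in>S. odd z \<longrightarrow> even (\<iota> z)"
      by (auto simp: planar_pairings_def pairings_def)
    moreover have "1 \<in> S" using assms by (simp add: S_def)
    ultimately have "\<iota> 1 \<in> S" "even (\<iota> 1)" by (auto simp: permutes_in_image)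
    then obtain j where "\<iota> 1 = 2 * j" "j \<in> {1..a + b}" by (auto simp: S_def)
    then show "\<iota> \<in> (\<Union>j\<in>{1..a + b}. G j)" using \<iota> by (auto simp: G_def)
  qed (auto simp: G_def)
  moreover have "card (\<Union>j\<in>{1..a + b}. G j) = (\<Sum>j\<in>{1..a + b}. card (G j))"
  proof (rule card_UN_disjoint)
    have "finite (planar_pairings S \<tau> {})" by (rule finite_planar_pairings) (simp add: S_def)
    then show "\<forall>j\<in>{1..a + b}. finite (G j)" by (simp add: G_def)
  qed (auto simp: G_def)
  moreover have "annulus a b = card (planar_pairings S \<tau> {})"
    using assms unfolding annulus_def S_def \<tau>_def by simp
  moreover have "(\<Sum>j\<in>{1..a + b}. card (G j)) =
      (\<Sum>j\<in>{1..a}. card (G j)) + (\<Sum>j\<in>{a + 1..a + b}. card (G j))"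
  proof -
    have "{1..a + b} = {1..a} \<union> {a + 1..a + b}" by auto
    then show ?thesis by (simp only:) (rule sum.union_disjoint; auto)
  qed
  ultimately have "annulus a b = (\<Sum>j\<in>{1..a}. card (G j)) + (\<Sum>j\<in>{a + 1..a + b}. card (G j))"
    by simp
  \<comment> \<open>Between \<open>1\<close> and \<open>2 * j\<close> lie \<open>2 * (j - 1)\<close>
    labels of the first face, behind \<open>2 * j\<close> another \<open>2 * (a - j)\<close>. These
    are the lengths of the two new faces once the unpaired labels are gone.\<close>
  moreover have "card (G j) = disc (a - j) * annulus (j - 1) b + annulus (a - j) b * disc (j - 1)"
    if j: "j \<in> {1..a}" for j
  proof -
    have "[2 * j..<1 + 2 * a] = 2 * j # [Suc (2 * j)..<1 + 2 * a]"
      using j by (intro upt_conv_Cons) auto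
    moreover have "[1..<1 + 2 * a] = 1 # [2..<1 + 2 * a]"
      using assms by (subst upt_conv_Cons) (auto simp: numeral_2_eq_2)
    moreover have "[2..<1 + 2 * a] = [2..<2 * j] @ [2 * j..<1 + 2 * a]"
      using j upt_add_eq_append[of 2 "2 * j" "1 + 2 * a - 2 * j"] by simp
    ultimately have xs: "xs = 1 # [2..<2 * j] @ 2 * j # [Suc (2 * j)..<1 + 2 * a]"
      by (simp only: xs_def)
    have "card {\<iota> \<in> planar_pairings (set (1 # [2..<2 * j] @ 2 * j # [Suc (2 * j)..<1 + 2 * a]) \<union> set ys) \<tau> {}.
        \<iota> 1 = 2 * j} = disc (a - j) * annulus (j - 1) b + annulus (a - j) b * disc (j - 1)"
      by (rule card_glue_same_face[OF fp(1) fp(2)[unfolded xs] fp(3) fp(6)[unfolded xs]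
            fp(4)[unfolded xs]])
        (use j assms in \<open>auto simp: ys_def\<close>)
    then show ?thesis by (simp only: G_def xs[symmetric] fp(5))
  qed
  \<comment> \<open>The length of the merged face does not depend on \<open>j\<close>, hence the
    factor \<open>b\<close>.\<close>
  moreover have "card (G j) = disc (a + b - 1)" if j: "j \<in> {a + 1..a + b}" for j
  proof -
    let ?L = "[1 + 2 * a..<2 * j]" and ?R = "[Suc (2 * j)..<1 + 2 * a + 2 * b]"
    have "[2 * j..<1 + 2 * a + 2 * b] = 2 * j # ?R"
      using j by (intro upt_conv_Cons) auto
    moreover have "[1 + 2 * a..<1 + 2 * a + 2 * b] = ?L @ [2 * j..<1 + 2 * a + 2 * b]"
      using j upt_add_eq_append[of "1 + 2 * a" "2 * j" "1 + 2 * a + 2 * b - 2 * j"] by simp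
    ultimately have ys: "ys = ?L @ 2 * j # ?R" by (simp only: ys_def)
    have tr: "traverses \<tau> (2 * j # ?R @ ?L)"
      using traverses_append_commute[of \<tau> ?L "2 * j # ?R"] fp(3) by (simp add: ys)
    have set_ys: "set (2 * j # ?R @ ?L) = set ys" by (auto simp: ys)
    have xs: "xs = 1 # [2..<1 + 2 * a]"
      unfolding xs_def using assms by (subst upt_conv_Cons) (auto simp: numeral_2_eq_2)
    have "card {\<iota> \<in> planar_pairings (set (1 # [2..<1 + 2 * a]) \<union> set (2 * j # ?R @ ?L)) \<tau> {}.
        \<iota> 1 = 2 * j} = disc (a + b - 1)"
    proof (rule card_glue_distinct_faces[OF fp(1) fp(2)[unfolded xs] tr
          fp(6)[folded set_ys, unfolded xs] fp(4)[folded set_ys, unfolded xs]])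
      show "length [2..<1 + 2 * a] + length (?R @ ?L) = 2 * (a + b - 1)" using j assms by auto
      show "?R @ ?L \<noteq> []" using j by auto
      show "[2..<1 + 2 * a] \<noteq> []" using assms by auto
    qed simp_all
    then show ?thesis by (simp only: G_def xs[symmetric] set_ys fp(5))
  qed
  ultimately have "annulus a b = (\<Sum>j\<in>{1..a}. disc (a - j) * annulus (j - 1) b) +
      (\<Sum>j\<in>{1..a}. annulus (a - j) b * disc (j - 1)) + b * disc (a + b - 1)"
    by (simp add: sum.distrib)
  \<comment> \<open>Counting \<open>j\<close> from the top here and from the bottom in the next sum
    produces the same expression twice, which is the factor 2.\<close>
  also have "(\<Sum>j\<in>{1..a}. disc (a - j) * annulus (j - 1) b) = (\<Sum>i<a. disc i * annulus (a - 1 - i) b)"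
    by (rule sum.reindex_bij_witness[of _ "\<lambda>i. a - i" "\<lambda>j. a - j"]) auto
  also have "(\<Sum>j\<in>{1..a}. annulus (a - j) b * disc (j - 1)) = (\<Sum>i<a. disc i * annulus (a - 1 - i) b)"
    by (rule sum.reindex_bij_witness[of _ "\<lambda>i. i + 1" "\<lambda>j. j - 1"]) (auto simp: mult.commute)
  finally show ?thesis by simp
qed

subsection \<open>Gluing data\<close>

text \<open>A set closed under the generators is closed under the generated group, and the group
  orbit of a point is itself a closed set.\<close>

lemma generate_transitive_iff:
  assumes p: "p permutes {1..n}" and q: "q permutes {1..n}"
  shows "(\<forall>x\<in>{1..n}. \<forall>y\<in>{1..n}. \<exists>g\<in>generate (sym_group n) {p, q}. g x = y) \<longleftrightarrow>
    transitive_on {q, p} {1..n}"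
proof
  assume tr: "\<forall>x\<in>{1..n}. \<forall>y\<in>{1..n}. \<exists>g\<in>generate (sym_group n) {p, q}. g x = y"
  show "transitive_on {q, p} {1..n}"
    unfolding transitive_on_def
  proof (intro allI impI)
    fix T assume T: "T \<subseteq> {1..n}" "T \<noteq> {}" "\<forall>h\<in>{q, p}. h ` T \<subseteq> T"
    have fin: "finite T" using T(1) finite_subset by blast
    have gT: "g ` T \<subseteq> T" if "g \<in> generate (sym_group n) {p, q}" for g
      using that
    proof induction
      case one
      then show ?case by (simp add: sym_group_one)
    next
      case (incl h)
      then show ?case using T(3) by blast
    next
      case (inv h)
      then have h: "h permutes {1..n}" "h ` T \<subseteq> T" using p q T(3) by auto
      \<comment> \<open>Finiteness of \<open>T\<close> is what makes it closed under inverses of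
        generators.\<close>
      then have "h ` T = T"
        by (intro permutation_image_eq fin) (auto simp: permutation_permutes)
      then have "inv' h ` T = T"
        using image_inv_f_f[OF permutes_inj[OF h(1)]] by metis
      then show ?case using h(1) by (simp add: sym_group_carrier)
    next
      case (eng g h)
      then show ?case unfolding sym_group_mult by (intro comp_image_subset)
    qed
    obtain u where u: "u \<in> T" using T(2) by blast
    have "y \<in> T" if "y \<in> {1..n}" for y
    proof -
      obtain g where "g \<in> generate (sym_group n) {p, q}" "g u = y"
        using tr u T(1) \<open>y \<in> {1..n}\<close> by blast
      then show ?thesis using gT u by blast
    qed
    then show "T = {1..n}" using T(1) by blast
  qed
next
  assume tr: "transitive_on {q, p} {1..n}"
  show "\<forall>x\<in>{1..n}. \<forall>y\<in>{1..n}. \<exists>g\<in>generate (sym_group n) {p, q}. g x = y"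
  proof (intro ballI)
    fix x y assume xy: "x \<in> {1..n}" "y \<in> {1..n}"
    let ?G = "generate (sym_group n) {p, q}"
    let ?T = "(\<lambda>g. g x) ` ?G"
    have "?G \<subseteq> carrier (sym_group n)"
      using p q by (intro group.generate_incl[OF sym_group_is_group]) (auto simp: sym_group_carrier)
    then have "g permutes {1..n}" if "g \<in> ?G" for g
      using that sym_group_carrier by blast
    from permutes_in_image[OF this] have sub: "?T \<subseteq> {1..n}"
      using xy(1) by blast
    have inv: "h ` ?T \<subseteq> ?T" if "h \<in> {p, q}" for h
    proof (rule image_subsetI)
      fix z assume "z \<in> ?T"
      then obtain g where g: "g \<in> ?G" "z = g x" by blast
      have "h \<circ> g \<in> ?G"
        using generate.eng[OF generate.incl[OF that] g(1)] by (simp add: sym_group_mult)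
      then show "h z \<in> ?T" using g(2) by (metis comp_apply image_eqI)
    qed
    have "x \<in> ?T"
      using imageI[OF generate.one[of "sym_group n" "{p, q}"], of "\<lambda>g. g x"]
      by (simp only: sym_group_one id_apply)
    then have "?T = {1..n}"
      by (rule transitive_on_pairD[OF tr sub _ inv inv]) simp_all
    with xy(2) have "y \<in> ?T" by (simp only:)
    then show "\<exists>g\<in>?G. g x = y" by blast
  qed
qed

lemma num_cycles_involution:
  assumes "finite S" "p ` S \<subseteq> S" "\<And>z. p (p z) = z" "\<And>z. z \<in> S \<Longrightarrow> p z \<noteq> z"
  shows "2 * num_cycles p S = card S"
proof -
  have orb: "orbit p z = {z, p z}" for z
  proof
    show "orbit p z \<subseteq> {z, p z}" by (rule orbit_subset_invariant) (use assms(3) in auto)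
    have "p z \<in> orbit p z" by (rule orbit.base)
    moreover from orbit.step[OF this] have "z \<in> orbit p z" by (simp add: assms(3))
    ultimately show "{z, p z} \<subseteq> orbit p z" by blast
  qed
  have "2 * card (orbit p ` S) = card (\<Union> (orbit p ` S))"
  proof (rule card_partition)
    show "card c = 2" if c: "c \<in> orbit p ` S" for c
    proof -
      obtain z where z: "z \<in> S" "c = {z, p z}" using c by (auto simp: orb)
      then show ?thesis using assms(4)[OF z(1)] by simp
    qed
    show "c1 \<inter> c2 = {}" if "c1 \<in> orbit p ` S" "c2 \<in> orbit p ` S" "c1 \<noteq> c2" for c1 c2
      using that assms(3) unfolding orb by (auto, metis+)
  qed (use assms(1) in \<open>auto simp: orb\<close>)
  moreover have "\<Union> (orbit p ` S) = S" using assms(2) by (auto simp: orb)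
  ultimately show ?thesis by (simp add: num_cycles_def)
qed

section \<open>Labels as polygon offset plus position\<close>

lemma offset_Cons_Suc: "offset (k # m) (Suc i) = k + offset m i"
  by (simp add: offset_def)

lemma ex_offset:
  assumes "x \<in> {1..sum_list m}"
  shows "\<exists>i<length m. \<exists>r\<in>{1..m ! i}. x = offset m i + r"
  using assms
proof (induction m arbitrary: x)
  case (Cons k m)
  show ?case
  proof (cases "x \<le> k")
    case True
    then show ?thesis using Cons.prems by (intro exI[of _ 0]) (auto simp: offset_def)
  next
    case False
    then have "x - k \<in> {1..sum_list m}" using Cons.prems by auto
    then obtain i r where ir: "i < length m" "r \<in> {1..m ! i}" "x - k = offset m i + r"
      using Cons.IH by blast
    then have "x = offset (k # m) (Suc i) + r" using False by (simp add: offset_Cons_Suc)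
    then show ?thesis using ir by (intro exI[of _ "Suc i"]) auto
  qed
qed simp

lemma offset_add_le:
  assumes "i < length m" "r \<in> {1..m ! i}"
  shows "offset m i + r \<in> {1..sum_list m}"
proof -
  have "sum_list m = sum_list (take (Suc i) m) + sum_list (drop (Suc i) m)"
    by (metis append_take_drop_id sum_list_append)
  moreover have "sum_list (take (Suc i) m) = offset m i + m ! i"
    using assms(1) by (simp add: take_Suc_conv_app_nth offset_def)
  ultimately show ?thesis using assms(2) by auto
qed

lemma even_offset: "\<forall>k\<in>set m. even k \<Longrightarrow> even (offset m i)"
  unfolding offset_def
  by (induction m arbitrary: i) (auto simp: take_Cons split: nat.split)

text \<open>All offsets are even when the polygons have even size, so the parity of a label is the
  parity of its position in its polygon.\<close>

lemma bicolored_iff: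
  assumes "sum_list m = n" "\<iota> permutes {1..n}"
  shows "bicolored (m, \<iota>) \<longleftrightarrow> (\<forall>k\<in>set m. even k) \<and> (\<forall>z\<in>{1..n}. odd z \<longrightarrow> even (\<iota> z))"
proof (cases "\<forall>k\<in>set m. even k")
  case True
  note ev = even_offset[OF True]
  have *: "(\<exists>j<length m. \<exists>r'\<in>{1..m ! j}. even r' \<and> \<iota> z = offset m j + r') \<longleftrightarrow> even (\<iota> z)"
    if "z \<in> {1..n}" for z
  proof -
    have "\<iota> z \<in> {1..sum_list m}" using that assms by (simp only: permutes_in_image)
    then obtain j r where jr: "j < length m" "r \<in> {1..m ! j}" "\<iota> z = offset m j + r"
      using ex_offset by blast
    show ?thesis
    proof
      assume "even (\<iota> z)"
      then have "even r" using jr(3) ev[of j] by simp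
      then show "\<exists>j<length m. \<exists>r'\<in>{1..m ! j}. even r' \<and> \<iota> z = offset m j + r'"
        using jr by blast
    next
      assume "\<exists>j<length m. \<exists>r'\<in>{1..m ! j}. even r' \<and> \<iota> z = offset m j + r'"
      then obtain j' r' where "even r'" "\<iota> z = offset m j' + r'" by blast
      then show "even (\<iota> z)" using ev[of j'] by simp
    qed
  qed
  show ?thesis
  proof
    assume b: "bicolored (m, \<iota>)"
    have "even (\<iota> z)" if z: "z \<in> {1..n}" "odd z" for z
    proof -
      obtain i r where ir: "i < length m" "r \<in> {1..m ! i}" "z = offset m i + r"
        using ex_offset[of z m] z(1) assms(1) by blast
      then have "odd r" using z(2) ev[of i] by simp
      then show ?thesis using b ir *[OF z(1)] unfolding bicolored_def by auto
    qed
    then show "(\<forall>k\<in>set m. even k) \<and> (\<forall>z\<in>{1..n}. odd z \<longrightarrow> even (\<iota> z))" using True by blast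
  next
    assume c: "(\<forall>k\<in>set m. even k) \<and> (\<forall>z\<in>{1..n}. odd z \<longrightarrow> even (\<iota> z))"
    have "\<exists>j<length m. \<exists>r'\<in>{1..m ! j}. even r' \<and> \<iota> (offset m i + r) = offset m j + r'"
      if ir: "i < length m" "r \<in> {1..m ! i}" "odd r" for i r
    proof -
      have "offset m i + r \<in> {1..n}" using offset_add_le[OF ir(1,2)] assms(1) by simp
      moreover have "odd (offset m i + r)" using ir(3) ev[of i] by simp
      ultimately show ?thesis using * c by blast
    qed
    then show "bicolored (m, \<iota>)" using True unfolding bicolored_def by auto
  qed
qed (auto simp: bicolored_def)

text \<open>With \<open>K\<close> faces and \<open>N\<close> pairs, genus zero means
  \<open>N - K + 2\<close> vertices; the three counts then add up to \<open>2 * N + 2\<close>, the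
  planarity equation on \<open>2 * N\<close> labels.\<close>

lemma bicolored_gluings_iff:
  assumes m: "length m = K" "\<forall>k\<in>set m. 1 \<le> k" "sum_list m = 2 * N" "\<forall>k\<in>set m. even k"
    and \<tau>: "face_perm m permutes {1..2 * N}" "num_cycles (face_perm m) {1..2 * N} = K"
  shows "(m, \<iota>) \<in> bicolored_gluings 0 N K \<longleftrightarrow> \<iota> \<in> planar_pairings {1..2 * N} (face_perm m) {}"
proof (cases "\<iota> permutes {1..2 * N} \<and> (\<forall>z\<in>{1..2 * N}. \<iota> (\<iota> z) = z \<and> \<iota> z \<noteq> z)")
  case True
  then have perm: "\<iota> permutes {1..2 * N}" by simp
  have inv: "\<iota> (\<iota> z) = z" for z
    using True permutes_not_in[OF perm, of z] by (cases "z \<in> {1..2 * N}") auto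
  have "2 * num_cycles \<iota> {1..2 * N} = card {1..2 * N}"
    by (rule num_cycles_involution[OF finite_atLeastAtMost _ inv])
      (use True in \<open>simp_all only: permutes_image[OF perm] order_refl not_False_eq_True\<close>)
  then have c: "num_cycles \<iota> {1..2 * N} = N" by simp
  have "connected_gluing N (m, \<iota>) \<longleftrightarrow> transitive_on {face_perm m, \<iota>} {1..2 * N}"
    unfolding connected_gluing_def using generate_transitive_iff[OF perm \<tau>(1)] by simp
  moreover have "has_genus N K (m, \<iota>) 0 \<longleftrightarrow> num_cycles (face_perm m) {1..2 * N} +
      num_cycles \<iota> {1..2 * N} + num_cycles (face_perm m \<circ> \<iota>) {1..2 * N} = card {1..2 * N} + 2"
    unfolding has_genus_def c \<tau>(2) by (simp, linarith)
  ultimately show ?thesis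
    using True inv m bicolored_iff[OF m(3) perm]
    by (auto simp: bicolored_gluings_def gluing_datum_def planar_pairings_def pairings_def planar_on_def)
next
  case False
  then show ?thesis
    by (auto simp: bicolored_gluings_def gluing_datum_def planar_pairings_def pairings_def)
qed

lemma num_cycles_traverses:
  assumes "permutation \<sigma>" "traverses \<sigma> xs" "xs \<noteq> []"
  shows "num_cycles \<sigma> (set xs) = 1"
  using num_cycles_orbit[OF assms(1), of "hd xs"] traverses_orbit[OF assms(2), of "hd xs"] assms(3)
  by simp

lemma face_perm_permutes: "face_perm m permutes {1..sum_list m}"
proof -
  \<comment> \<open>Any list of valid indices is allowed, so that the fold can be unwound by
    induction.\<close>
  have "foldr (\<lambda>i p. cycle_of_list (polygon m i) \<circ> p) is id permutes {1..sum_list m}"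
    if "set is \<subseteq> {..<length m}" for "is"
    using that
  proof (induction "is")
    case (Cons i "is")
    have "set (polygon m i) \<subseteq> {1..sum_list m}"
    proof
      fix x assume "x \<in> set (polygon m i)"
      then have "x = offset m i + (x - offset m i)" "x - offset m i \<in> {1..m ! i}"
        using Cons.prems by (auto simp: polygon_def offset_def take_Suc_conv_app_nth)
      then show "x \<in> {1..sum_list m}" using offset_add_le[of i m "x - offset m i"] Cons.prems by auto
    qed
    then have "cycle_of_list (polygon m i) permutes {1..sum_list m}"
      by (rule permutes_subset[OF cycle_permutes])
    moreover have "foldr (\<lambda>i p. cycle_of_list (polygon m i) \<circ> p) is id permutes {1..sum_list m}"
      by (rule Cons.IH) (use Cons.prems in simp)
    ultimately show ?case
      unfolding foldr.simps comp_apply[of "\<lambda>p. cycle_of_list (polygon m i) \<circ> p"]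
      by (rule permutes_compose[rotated])
  qed (simp add: permutes_id)
  then show ?thesis unfolding face_perm_def by (simp add: atLeast0LessThan)
qed

lemma B_one_face: "B 0 N 1 = disc N"
proof (cases "N = 0")
  case True
  then show ?thesis by (simp add: B_def disc_def)
next
  case False
  let ?P = "planar_pairings {1..2 * N} (face_perm [2 * N]) {}"
  note fp = face_perm_single[of N]
  have "[1..<1 + 2 * N] \<noteq> []" using False by simp
  then have "num_cycles (face_perm [2 * N]) {1..2 * N} = 1"
    using num_cycles_traverses[OF fp(1,2)] fp(4) by simp
  then have iff: "([2 * N], \<iota>) \<in> bicolored_gluings 0 N 1 \<longleftrightarrow> \<iota> \<in> ?P" for \<iota>
    using False face_perm_permutes[of "[2 * N]"] by (intro bicolored_gluings_iff) auto
  have "m = [2 * N]" if "(m, \<iota>) \<in> bicolored_gluings 0 N 1" for m \<iota>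
    using that by (auto simp: bicolored_gluings_def gluing_datum_def length_Suc_conv)
  then have "bicolored_gluings 0 N 1 = {[2 * N]} \<times> ?P" using iff by auto
  then show ?thesis using False by (simp add: B_def disc_def card_cartesian_product)
qed

text \<open>The gluings are sorted by half the length of the first face; colored faces have even
  length, and the second one is then determined.\<close>

lemma B_two_faces: "B 0 N 2 = (\<Sum>a\<in>{1..<N}. annulus a (N - a))"
proof (cases "N = 0")
  case True
  then show ?thesis by (simp add: B_def)
next
  case False
  let ?P = "\<lambda>a. planar_pairings {1..2 * N} (face_perm [2 * a, 2 * (N - a)]) {}"
  have iff: "([2 * a, 2 * (N - a)], \<iota>) \<in> bicolored_gluings 0 N 2 \<longleftrightarrow> \<iota> \<in> ?P a"
    if a: "a \<in> {1..<N}" for a \<iota>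
  proof (rule bicolored_gluings_iff)
    let ?m = "[2 * a, 2 * (N - a)]"
    show sum: "sum_list ?m = 2 * N" using a by auto
    show "face_perm ?m permutes {1..2 * N}" using face_perm_permutes[of ?m] unfolding sum .
    note fp = face_perm_double[of a "N - a"]
    have eq: "a + (N - a) = N" using a by auto
    have ne: "[1..<1 + 2 * a] \<noteq> []" "[1 + 2 * a..<1 + 2 * a + 2 * (N - a)] \<noteq> []" using a by auto
    have "num_cycles (face_perm ?m) (set [1..<1 + 2 * a] \<union> set [1 + 2 * a..<1 + 2 * a + 2 * (N - a)]) =
        num_cycles (face_perm ?m) (set [1..<1 + 2 * a]) +
        num_cycles (face_perm ?m) (set [1 + 2 * a..<1 + 2 * a + 2 * (N - a)])"
      by (rule num_cycles_Un[OF fp(1) finite_set finite_set])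
        (use fp(6) traverses_image[OF fp(2)] traverses_image[OF fp(3)] in simp_all)
    also have "\<dots> = 2"
      using num_cycles_traverses[OF fp(1,2) ne(1)] num_cycles_traverses[OF fp(1,3) ne(2)] by simp
    finally show "num_cycles (face_perm ?m) {1..2 * N} = 2"
      unfolding fp(5) eq .
  qed (use a in auto)
  have form: "\<exists>a\<in>{1..<N}. m = [2 * a, 2 * (N - a)]" if d: "(m, \<iota>) \<in> bicolored_gluings 0 N 2" for m \<iota>
  proof -
    obtain p q where m: "m = [p, q]" "1 \<le> p" "1 \<le> q" "p + q = 2 * N" "even p" "even q"
    proof -
      have "length m = 2" "\<forall>k\<in>set m. 1 \<le> k \<and> even k" "sum_list m = 2 * N"
        using d by (auto simp: bicolored_gluings_def gluing_datum_def bicolored_def)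
      then show thesis using that by (cases m; cases "tl m") auto
    qed
    obtain a b where ab: "p = 2 * a" "q = 2 * b" using m(5,6) by (elim evenE)
    then have "a \<in> {1..<N}" "b = N - a" using m by auto
    then show ?thesis using m(1) ab by blast
  qed
  have "bicolored_gluings 0 N 2 = (\<Union>a\<in>{1..<N}. {[2 * a, 2 * (N - a)]} \<times> ?P a)"
    (is "_ = (\<Union>a\<in>_. ?Q a)")
  proof (intro equalityI subsetI)
    fix d assume d: "d \<in> bicolored_gluings 0 N 2"
    obtain m \<iota> where d_eq: "d = (m, \<iota>)" by (cases d)
    obtain a where a: "a \<in> {1..<N}" "m = [2 * a, 2 * (N - a)]" using form d d_eq by blast
    then have "d \<in> ?Q a" using d iff[OF a(1)] by (simp add: d_eq)
    then show "d \<in> (\<Union>a\<in>{1..<N}. ?Q a)" using a(1) by blast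
  next
    fix d assume "d \<in> (\<Union>a\<in>{1..<N}. ?Q a)"
    then show "d \<in> bicolored_gluings 0 N 2" using iff by auto
  qed
  moreover have "card (\<Union>a\<in>{1..<N}. ?Q a) = (\<Sum>a\<in>{1..<N}. card (?Q a))"
    by (rule card_UN_disjoint) (auto intro!: finite_cartesian_product finite_planar_pairings)
  moreover have "card (?Q a) = annulus a (N - a)" if "a \<in> {1..<N}" for a
    using that by (simp add: card_cartesian_product annulus_def)
  ultimately show ?thesis using False by (simp add: B_def)
qed

theorem theorem3:
  fixes N :: nat
  assumes "N \<ge> 2"
  shows "B 0 N 2 = 2 * (\<Sum>i<N - 2. B 0 i 1 * B 0 (N - i - 1) 2) + (N * (N - 1) div 2) * B 0 (N - 1) 1"
proof -
  have "B 0 N 2 = (\<Sum>a\<in>{1..<N}. 2 * (\<Sum>i<a. disc i * annulus (a - 1 - i) (N - a)) +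
      (N - a) * disc (N - 1))"
    unfolding B_two_faces by (rule sum.cong) (auto simp: annulus_rec)
  also have "\<dots> = 2 * (\<Sum>a\<in>{1..<N}. \<Sum>i<a. disc i * annulus (a - 1 - i) (N - a)) +
      (\<Sum>a\<in>{1..<N}. N - a) * disc (N - 1)"
    by (simp add: sum.distrib sum_distrib_left sum_distrib_right)
  \<comment> \<open>Summing the number of possible partners on the second face over all face lengths
    gives a triangular number.\<close>
  also have "(\<Sum>a\<in>{1..<N}. N - a) = (\<Sum>a\<in>{1..<N}. a)"
    by (rule sum.reindex_bij_witness[of _ "\<lambda>a. N - a" "\<lambda>a. N - a"]) auto
  also have "\<dots> = (\<Sum>a\<in>{0..<N}. a)"
    by (rule sum.mono_neutral_left) auto
  also have "\<dots> = N * (N - 1) div 2"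
    by (simp add: Sum_Ico_nat)
  \<comment> \<open>The triangular double sum is read by \<open>i\<close> first, so that the annuli
    with the same total size are collected.\<close>
  also have "(\<Sum>a\<in>{1..<N}. \<Sum>i<a. disc i * annulus (a - 1 - i) (N - a)) =
      (\<Sum>i<N - 1. \<Sum>a\<in>{i + 1..<N}. disc i * annulus (a - 1 - i) (N - a))"
    unfolding sum.Sigma[OF finite_atLeastLessThan, simplified] sum.Sigma[OF finite_lessThan, simplified]
    by (subst (1 2) sum.Sigma; (simp; fail)?)
      (rule sum.reindex_bij_witness[of _ prod.swap prod.swap]; auto)
  also have "\<dots> = (\<Sum>i<N - 1. disc i * (\<Sum>a\<in>{1..<N - i - 1}. annulus a (N - i - 1 - a)))"
  proof (rule sum.cong[OF refl])
    fix i assume i: "i \<in> {..<N - 1}"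
    \<comment> \<open>After shifting by \<open>i + 1\<close> the sum starts at 0, where
      \<open>annulus 0 b = 0\<close>; dropping this term leaves the sum that expresses
      \<open>B 0 (N - i - 1) 2\<close>.\<close>
    have "(\<Sum>a\<in>{i + 1..<N}. annulus (a - 1 - i) (N - a)) =
        (\<Sum>a\<in>{0..<N - i - 1}. annulus a (N - i - 1 - a))"
      by (rule sum.reindex_bij_witness[of _ "\<lambda>a. a + i + 1" "\<lambda>a. a - 1 - i"]) auto
    also have "\<dots> = (\<Sum>a\<in>{1..<N - i - 1}. annulus a (N - i - 1 - a))"
      by (rule sum.mono_neutral_right) (auto simp: annulus_def)
    finally show "(\<Sum>a\<in>{i + 1..<N}. disc i * annulus (a - 1 - i) (N - a)) =
        disc i * (\<Sum>a\<in>{1..<N - i - 1}. annulus a (N - i - 1 - a))"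
      by (simp only: flip: sum_distrib_left)
  qed
  also have "\<dots> = (\<Sum>i<N - 1. B 0 i 1 * B 0 (N - i - 1) 2)"
    by (simp only: B_one_face B_two_faces)
  \<comment> \<open>The term \<open>i = N - 2\<close> contains \<open>B 0 1 2\<close>, which is zero
    since two colored faces need at least four labels.\<close>
  also have "\<dots> = (\<Sum>i<N - 2. B 0 i 1 * B 0 (N - i - 1) 2)"
  proof -
    have "N - 1 = Suc (N - 2)" using assms by simp
    moreover have "B 0 (N - (N - 2) - 1) 2 = 0" using assms by (simp add: B_two_faces)
    ultimately show ?thesis by simp
  qed
  finally show ?thesis by (simp only: B_one_face)
qed

end
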